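(* Let $1\le p,q\le\infty$ and $1<r<\infty$. Let $X$ be an $r$-convex Banach function space over $(\Omega,\Sigma,\mu)$ and $Y$ an $r$-concave Banach function space over $(\Omega',\Sigma',\nu)$ such that $X$ and $Y'$ are order continuous. Let $T:X\to Y$ be an operator. Suppose that $$[q,p]\cap[\min\{r,2\},\max\{r,2\}]\neq\emptyset.$$ The following statements are equivalent. (i) The operator $T:X\to Y$ is $r$-regular. (ii) There is a constant $K>0$ such that for each matrix $(x_{i,j})_{i=1,j=1}^{n,m}$ of elements of $X$, $$\Big\|\Big(\sum_{i=1}^n\big(\sum_{j=1}^m|Tx_{i,j}|^p\big)^{\frac rp}\Big)^{\frac1r}\Big\|_Y\le K\,\Big\|\Big(\sum_{i=1}^n\big(\sum_{j=1}^m|x_{i,j}|^q\big)^{\frac rq}\Big)^{\frac1r}\Big\|_X.$$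
   Context: A Banach function space over a measure space is a Banach lattice of (a.e. classes of) measurable functions which is an order ideal in the space of all measurable functions. $Y'$ denotes the dual of $Y$, identified by order continuity with a space of measurable functions through $\langle y,y'\rangle=\int yy'\,d\nu$. "Operator" means bounded linear operator. The condition on $[q,p]$ includes in particular $q\le p$. When an exponent is $\infty$ the corresponding $\ell^p$-type expression is replaced by the supremum $\bigvee|\cdot|$. A linear map $T:X\to Y$ between Banach lattices is $r$-regular if there is $K>0$ with $\big\|(\sum_{i=1}^n|Tx_i|^r)^{1/r}\big\|\le K\big\|(\sum_{i=1}^n|x_i|^r)^{1/r}\big\|$ for every finite family $\{x_i\}_{i=1}^n\subset X$. $X$ is $r$-convex if there is $M$ with $\|(\sum|x_i|^r)^{1/r}\|\le M(\sum\|x_i\|^r)^{1/r}$ for all finite families; $Y$ is $r$-concave if there is $M$ with $(\sum\|y_i\|^r)^{1/r}\le M\|(\sum|y_i|^r)^{1/r}\|$ for all finite families. *)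

theory Defs
  imports "HOL-Analysis.Analysis"
begin

text \<open>
  A Banach function space over \<open>M\<close> is a set \<open>X\<close> of real measurable functions together with a
  norm \<open>N\<close>. Its elements are representatives of a.e. classes: order and equality are taken
  almost everywhere, and \<open>X\<close> is closed under a.e. equality by the ideal property.
  Values of \<open>N\<close> outside \<open>X\<close> are irrelevant.
\<close>

locale banach_function_space =
  fixes M :: "'a measure" and X :: "('a \<Rightarrow> real) set" and N :: "('a \<Rightarrow> real) \<Rightarrow> real"
  assumes measurable: "X \<subseteq> borel_measurable M"
    and zero_closed: "(\<lambda>_. 0) \<in> X"
    and add_closed: "\<And>f g. f \<in> X \<Longrightarrow> g \<in> X \<Longrightarrow> (\<lambda>w. f w + g w) \<in> X"
    and scale_closed: "\<And>c f. f \<in> X \<Longrightarrow> (\<lambda>w. c * f w) \<in> X"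
    and ideal: "\<And>f g. f \<in> borel_measurable M \<Longrightarrow> g \<in> X \<Longrightarrow>
          (AE w in M. \<bar>f w\<bar> \<le> \<bar>g w\<bar>) \<Longrightarrow> f \<in> X"
    and norm_definite: "\<And>f. f \<in> X \<Longrightarrow> N f = 0 \<Longrightarrow> AE w in M. f w = 0"
    and norm_triangle: "\<And>f g. f \<in> X \<Longrightarrow> g \<in> X \<Longrightarrow> N (\<lambda>w. f w + g w) \<le> N f + N g"
    and norm_scale: "\<And>c f. f \<in> X \<Longrightarrow> N (\<lambda>w. c * f w) = \<bar>c\<bar> * N f"
    and norm_lattice: "\<And>f g. f \<in> X \<Longrightarrow> g \<in> X \<Longrightarrow>
          (AE w in M. \<bar>f w\<bar> \<le> \<bar>g w\<bar>) \<Longrightarrow> N f \<le> N g"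
    and complete: "\<And>s :: nat \<Rightarrow> 'a \<Rightarrow> real. (\<And>n. s n \<in> X) \<Longrightarrow>
          (\<And>e. e > 0 \<Longrightarrow> \<exists>k. \<forall>m\<ge>k. \<forall>n\<ge>k. N (\<lambda>w. s m w - s n w) < e) \<Longrightarrow>
          \<exists>f\<in>X. (\<lambda>n. N (\<lambda>w. s n w - f w)) \<longlonglongrightarrow> 0"

text \<open>
  The \<open>\<ell>\<^sup>p\<close>-expression of a finite family. The inserted \<open>0\<close> only matters for the empty family.
\<close>

definition ell :: "ereal \<Rightarrow> nat \<Rightarrow> (nat \<Rightarrow> real) \<Rightarrow> real" where
  "ell p n a =
     (if p = \<infinity> then Max (insert 0 ((\<lambda>i. \<bar>a i\<bar>) ` {..<n}))
      else (\<Sum>i<n. \<bar>a i\<bar> powr real_of_ereal p) powr (1 / real_of_ereal p))"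

definition lattice_convex :: "ereal \<Rightarrow> ('a \<Rightarrow> real) set \<Rightarrow> (('a \<Rightarrow> real) \<Rightarrow> real) \<Rightarrow> bool" where
  "lattice_convex r X N \<longleftrightarrow>
     (\<exists>C. \<forall>n x. (\<forall>i<n. x i \<in> X) \<longrightarrow>
        N (\<lambda>w. ell r n (\<lambda>i. x i w)) \<le> C * ell r n (\<lambda>i. N (x i)))"

definition lattice_concave :: "ereal \<Rightarrow> ('a \<Rightarrow> real) set \<Rightarrow> (('a \<Rightarrow> real) \<Rightarrow> real) \<Rightarrow> bool" where
  "lattice_concave r Y N \<longleftrightarrow>
     (\<exists>C. \<forall>n y. (\<forall>i<n. y i \<in> Y) \<longrightarrow>
        ell r n (\<lambda>i. N (y i)) \<le> C * N (\<lambda>w. ell r n (\<lambda>i. y i w)))"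

text \<open>
  A norm on a vector lattice is order continuous if it tends to \<open>0\<close> along every downward
  directed set with infimum \<open>0\<close>. As the norm is monotone on positive elements, this says that
  the set has elements of arbitrarily small norm. The lattice is given by a carrier \<open>V\<close> of
  functions and a preorder \<open>le\<close>, elements equivalent under \<open>le\<close> being identified.
\<close>

definition order_continuous_norm ::
    "('i \<Rightarrow> real) set \<Rightarrow> (('i \<Rightarrow> real) \<Rightarrow> ('i \<Rightarrow> real) \<Rightarrow> bool) \<Rightarrow> (('i \<Rightarrow> real) \<Rightarrow> real) \<Rightarrow> bool" where
  "order_continuous_norm V le N \<longleftrightarrow>
     (\<forall>D. D \<subseteq> V \<and> D \<noteq> {} \<and>
          (\<forall>u\<in>D. \<forall>v\<in>D. \<exists>w\<in>D. le w u \<and> le w v) \<and>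
          (\<forall>u\<in>D. le (\<lambda>_. 0) u) \<and>
          (\<forall>l\<in>V. (\<forall>u\<in>D. le l u) \<longrightarrow> le l (\<lambda>_. 0))
        \<longrightarrow> (\<forall>e>0. \<exists>u\<in>D. N u < e))"

definition ae_le :: "'a measure \<Rightarrow> ('a \<Rightarrow> real) \<Rightarrow> ('a \<Rightarrow> real) \<Rightarrow> bool" where
  "ae_le M f g \<longleftrightarrow> (AE w in M. f w \<le> g w)"

text \<open>
  The dual of a Banach function space \<open>Y\<close>, as the Banach lattice of bounded linear functionals on
  \<open>Y\<close> with the dual order and the dual norm. Wherever it can be identified with a space of measurable
  functions through \<open>\<langle>y, y'\<rangle> = \<integral> y y' d\<nu>\<close>, order and norm are those transported from here.
\<close>

definition dual_carrier ::
    "('b \<Rightarrow> real) set \<Rightarrow> (('b \<Rightarrow> real) \<Rightarrow> real) \<Rightarrow> (('b \<Rightarrow> real) \<Rightarrow> real) set" where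
  "dual_carrier Y N =
     {\<phi>. (\<forall>f\<in>Y. \<forall>g\<in>Y. \<phi> (\<lambda>w. f w + g w) = \<phi> f + \<phi> g) \<and>
         (\<forall>c. \<forall>f\<in>Y. \<phi> (\<lambda>w. c * f w) = c * \<phi> f) \<and>
         (\<exists>C. \<forall>f\<in>Y. \<bar>\<phi> f\<bar> \<le> C * N f)}"

definition dual_le ::
    "'b measure \<Rightarrow> ('b \<Rightarrow> real) set \<Rightarrow> (('b \<Rightarrow> real) \<Rightarrow> real) \<Rightarrow> (('b \<Rightarrow> real) \<Rightarrow> real) \<Rightarrow> bool" where
  "dual_le M Y \<phi> \<psi> \<longleftrightarrow> (\<forall>f\<in>Y. ae_le M (\<lambda>_. 0) f \<longrightarrow> \<phi> f \<le> \<psi> f)"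

definition dual_norm ::
    "('b \<Rightarrow> real) set \<Rightarrow> (('b \<Rightarrow> real) \<Rightarrow> real) \<Rightarrow> (('b \<Rightarrow> real) \<Rightarrow> real) \<Rightarrow> real" where
  "dual_norm Y N \<phi> = Sup {\<bar>\<phi> f\<bar> | f. f \<in> Y \<and> N f \<le> 1}"

text \<open>
  Bounded linear maps between Banach function spaces. Linearity is an equality of a.e. classes;
  with boundedness it implies that \<open>T\<close> maps a.e. equal functions to a.e. equal functions.
\<close>

definition bounded_operator ::
    "('a \<Rightarrow> real) set \<Rightarrow> (('a \<Rightarrow> real) \<Rightarrow> real) \<Rightarrow>
     'b measure \<Rightarrow> ('b \<Rightarrow> real) set \<Rightarrow> (('b \<Rightarrow> real) \<Rightarrow> real) \<Rightarrow>
     (('a \<Rightarrow> real) \<Rightarrow> 'b \<Rightarrow> real) \<Rightarrow> bool" where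
  "bounded_operator X NX M' Y NY T \<longleftrightarrow>
     (\<forall>f\<in>X. T f \<in> Y) \<and>
     (\<forall>f\<in>X. \<forall>g\<in>X. AE w in M'. T (\<lambda>v. f v + g v) w = T f w + T g w) \<and>
     (\<forall>c. \<forall>f\<in>X. AE w in M'. T (\<lambda>v. c * f v) w = c * T f w) \<and>
     (\<exists>C. \<forall>f\<in>X. NY (T f) \<le> C * NX f)"

definition regular_operator ::
    "ereal \<Rightarrow> ('a \<Rightarrow> real) set \<Rightarrow> (('a \<Rightarrow> real) \<Rightarrow> real) \<Rightarrow> (('b \<Rightarrow> real) \<Rightarrow> real) \<Rightarrow>
     (('a \<Rightarrow> real) \<Rightarrow> 'b \<Rightarrow> real) \<Rightarrow> bool" where
  "regular_operator r X NX NY T \<longleftrightarrow>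
     (\<exists>K>0. \<forall>n x. (\<forall>i<n. x i \<in> X) \<longrightarrow>
        NY (\<lambda>w. ell r n (\<lambda>i. T (x i) w)) \<le> K * NX (\<lambda>w. ell r n (\<lambda>i. x i w)))"

end

theory Submission
  imports Defs
begin

text \<open>
  For \<open>(i) \<Longrightarrow> (ii)\<close> choose \<open>s \<in> [q, p]\<close> between \<open>r\<close> and \<open>2\<close>; as finite \<open>\<ell>\<^sup>p\<close>-norms decrease in the exponent,
  it suffices to treat \<open>p = q = s\<close>. Bounds for the mixed norms \<open>\<ell>\<^sup>r(\<ell>\<^sup>t)\<close> are passed from one inner
  exponent \<open>t\<close> to another \<open>s\<close> by realising \<open>\<ell>\<^sup>s\<close> on \<open>m\<close> coordinates, with constants independent of
  \<open>m\<close>, either as a subspace or as a quotient of a finite-dimensional \<open>L\<^sup>r(\<ell>\<^sup>t)\<close>: linear combinations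
  commute with \<open>T\<close>, and the \<open>L\<^sup>r\<close>-norm is absorbed into the outer \<open>\<ell>\<^sup>r\<close>-sum. Khintchine's inequality
  leads from \<open>t = r\<close> to \<open>s = 2\<close>. From \<open>t = 2\<close> one reaches \<open>r < s < 2\<close> with independent weights
  \<open>\<theta>\<^sub>j\<close> of Pareto type, \<open>P(\<theta>\<^sub>j = 2\<^sup>l) \<approx> 2\<^sup>-\<^sup>s\<^sup>l\<close>, for which \<open>E (\<Sum> \<bar>\<theta>\<^sub>j a\<^sub>j\<bar>\<^sup>2)\<^sup>r\<^sup>/\<^sup>2 \<approx> (\<Sum> \<bar>a\<^sub>j\<bar>\<^sup>s)\<^sup>r\<^sup>/\<^sup>s\<close>. For
  \<open>2 < s < r\<close> the dual construction, with the conjugate exponents, presents \<open>\<ell>\<^sup>s\<close> as a quotient, and the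
  lift of a vector is an explicit measurable function of it, so it can be applied pointwise.
\<close>

subsection \<open>Finite \<open>\<ell>\<^sup>p\<close>-norms\<close>

definition lp :: "real \<Rightarrow> 'i set \<Rightarrow> ('i \<Rightarrow> real) \<Rightarrow> real" where
  "lp t B a = (\<Sum>i\<in>B. \<bar>a i\<bar> powr t) powr (1 / t)"

lemma lp_nonneg [simp]: "0 \<le> lp t B a"
  by (simp add: lp_def)

lemma lp_powr: "t > 0 \<Longrightarrow> lp t B a powr t = (\<Sum>i\<in>B. \<bar>a i\<bar> powr t)"
  by (simp add: lp_def powr_powr sum_nonneg)

lemma lp_cong: "(\<And>i. i \<in> B \<Longrightarrow> \<bar>a i\<bar> = \<bar>b i\<bar>) \<Longrightarrow> lp t B a = lp t B b"
  unfolding lp_def by (metis (no_types, lifting) sum.cong)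

lemma lp_scale: "t > 0 \<Longrightarrow> lp t B (\<lambda>i. c * a i) = \<bar>c\<bar> * lp t B a"
  by (simp add: lp_def abs_mult powr_mult powr_powr sum_nonneg flip: sum_distrib_left)

lemma lp_mono:
  assumes "t > 0" "\<And>i. i \<in> B \<Longrightarrow> \<bar>a i\<bar> \<le> \<bar>b i\<bar>"
  shows "lp t B a \<le> lp t B b"
  unfolding lp_def using assms by (intro powr_mono2 sum_mono sum_nonneg) auto

lemma lp_member:
  assumes "t > 0" "finite B" "i \<in> B"
  shows "\<bar>a i\<bar> \<le> lp t B a"
proof -
  have "\<bar>a i\<bar> = (\<bar>a i\<bar> powr t) powr (1 / t)"
    using assms by (simp add: powr_powr)
  also have "\<dots> \<le> lp t B a"
    unfolding lp_def using assms by (intro powr_mono2 member_le_sum) auto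
  finally show ?thesis .
qed

lemma lp_zero [simp]: "lp t B (\<lambda>i. 0) = 0"
  by (simp add: lp_def)

lemma lp_sing: "t > 0 \<Longrightarrow> lp t {i} a = \<bar>a i\<bar>"
  by (simp add: lp_def powr_powr)

lemma lp_normalize:
  assumes "finite B" "t > 0" "lp t B a \<noteq> 0"
  shows "lp t B (\<lambda>i. a i / lp t B a) = 1"
  using lp_scale[of t B "1 / lp t B a" a] assms by simp

text \<open>Homogeneity reduces the bound to unit vectors. A vector of norm 0 is known to vanish on
  \<open>B\<close> only, so \<open>cong\<close> replaces it by the zero vector, where
  \<open>F\<close> is 0.\<close>

lemma lp_bounded_by_normalized:
  assumes "finite B" "t > 0"
    and scale: "\<And>c a. F (\<lambda>i. c * a i) = \<bar>c\<bar> * F a"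
    and cong: "\<And>a b. (\<And>i. i \<in> B \<Longrightarrow> a i = b i) \<Longrightarrow> F a = F b"
    and unit: "\<And>a. lp t B a = 1 \<Longrightarrow> F a \<le> C"
  shows "F a \<le> C * lp t B a"
proof (cases "lp t B a = 0")
  case True
  then have "a i = 0" if "i \<in> B" for i
    using lp_member[OF assms(2,1) that, of a] by simp
  then have "F a = F (\<lambda>i. 0 * a i)"
    by (intro cong) simp
  also have "\<dots> = 0"
    using scale[of 0 a] by simp
  finally show ?thesis using True by simp
next
  case False
  then have pos: "lp t B a > 0"
    using lp_nonneg[of t B a] by linarith
  have "F (\<lambda>i. (1 / lp t B a) * a i) \<le> C"
    using lp_normalize[OF assms(1,2) False] by (intro unit) simp
  then have "F a / lp t B a \<le> C"
    using scale[of "1 / lp t B a" a] pos by simp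
  then show ?thesis using pos by (simp add: field_simps)
qed

lemma lp_bounds_normalized:
  assumes "finite B" "t > 0" "C > 0"
    and scale: "\<And>c a. F (\<lambda>i. c * a i) = \<bar>c\<bar> * F a"
    and nonneg: "\<And>a. 0 \<le> F a"
    and unit: "\<And>a. lp t B a = 1 \<Longrightarrow> 1 \<le> C * F a"
  shows "lp t B a \<le> C * F a"
proof (cases "lp t B a = 0")
  case True
  then show ?thesis using nonneg[of a] assms(3) by simp
next
  case False
  then have pos: "lp t B a > 0"
    using lp_nonneg[of t B a] by linarith
  have "1 \<le> C * F (\<lambda>i. (1 / lp t B a) * a i)"
    using lp_normalize[OF assms(1,2) False] by (intro unit) simp
  also have "\<dots> = C * F a / lp t B a"
    using pos scale[of "1 / lp t B a" a] by simp
  finally show ?thesis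
    using pos by (simp add: field_simps)
qed

text \<open>After normalisation in the exponent \<open>s\<close> all entries are at most 1 in
  modulus, and powers of such numbers decrease in the exponent.\<close>

lemma lp_antimono:
  assumes "finite B" "0 < s" "s \<le> t"
  shows "lp t B a \<le> lp s B a"
proof -
  have "lp t B a \<le> 1 * lp s B a"
  proof (rule lp_bounded_by_normalized)
    fix a :: "'a \<Rightarrow> real" assume unit: "lp s B a = 1"
    have "\<bar>a i\<bar> powr t \<le> \<bar>a i\<bar> powr s" if "i \<in> B" for i
      using lp_member[OF \<open>0 < s\<close> \<open>finite B\<close> that, of a] unit assms
      by (intro powr_mono') auto
    then have "(\<Sum>i\<in>B. \<bar>a i\<bar> powr t) \<le> lp s B a powr s"
      using assms by (simp add: lp_powr sum_mono)
    then show "lp t B a \<le> 1"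
      unfolding lp_def[of t] using assms unit by (intro powr_le1) (auto simp: sum_nonneg)
  qed (use assms in \<open>auto simp: lp_scale intro: lp_cong\<close>)
  then show ?thesis by simp
qed

lemma lp_le_sum:
  assumes "finite B" "1 \<le> t"
  shows "lp t B a \<le> (\<Sum>i\<in>B. \<bar>a i\<bar>)"
  using lp_antimono[of B 1 t a] assms by (simp add: lp_def sum_nonneg)

lemma lp_measurable [measurable]:
  assumes "\<And>i. i \<in> B \<Longrightarrow> (\<lambda>w. a i w) \<in> borel_measurable M"
  shows "(\<lambda>w. lp t B (\<lambda>i. a i w)) \<in> borel_measurable M"
  unfolding lp_def using assms by measurable

text \<open>This Fubini identity lets an inner \<open>L^r\<close> average be absorbed into the outer
  \<open>\<ell>^r\<close>-sum.\<close>

lemma lp_Times: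
  assumes "t > 0"
  shows "lp t (A \<times> B) (\<lambda>(i, j). a i j) = lp t A (\<lambda>i. lp t B (a i))"
  using assms by (simp add: lp_powr lp_def[of _ "A \<times> B"] lp_def[of _ A] case_prod_beta sum.cartesian_product)

lemma lp_reindex:
  assumes "bij_betw h A B"
  shows "lp t A (\<lambda>i. a (h i)) = lp t B a"
  unfolding lp_def by (subst sum.reindex_bij_betw[OF assms]) simp

lemma ell_ereal: "ell (ereal p) n a = lp p {..<n} a"
  by (simp add: ell_def lp_def)

lemma ell_le_lp:
  assumes "0 < s" "ereal s \<le> p"
  shows "ell p n a \<le> lp s {..<n} a"
proof (cases p)
  case (real p')
  then show ?thesis using assms by (simp add: ell_ereal lp_antimono)
next
  case PInf
  then show ?thesis using assms lp_member[of s "{..<n}" _ a]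
    by (auto simp: ell_def)
qed (use assms in auto)

lemma lp_le_ell:
  assumes "1 \<le> q" "q \<le> ereal s"
  shows "lp s {..<n} a \<le> ell q n a"
  using assms by (cases q) (auto simp: ell_ereal intro!: lp_antimono)

lemma ell_nonneg: "0 \<le> ell p n a"
  by (auto simp: ell_def)

subsection \<open>Finite product probability spaces\<close>

text \<open>The law of \<open>m\<close> independent random levels in \<open>{0..L}\<close>, each
  with weights \<open>\<omega>\<close>. Finiteness of the space makes expectations finite linear
  combinations, with which operators commute.\<close>

locale product_weights =
  fixes m L :: nat and \<omega> :: "nat \<Rightarrow> real"
  assumes \<omega>_pos: "\<And>l. l \<le> L \<Longrightarrow> 0 < \<omega> l"
    and \<omega>_sum: "(\<Sum>l\<le>L. \<omega> l) = 1"
begin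

definition \<Omega> :: "(nat \<Rightarrow> nat) set" where
  "\<Omega> = PiE {..<m} (\<lambda>_. {..L})"

definition W :: "(nat \<Rightarrow> nat) \<Rightarrow> real" where
  "W k = (\<Prod>j<m. \<omega> (k j))"

definition E :: "((nat \<Rightarrow> nat) \<Rightarrow> real) \<Rightarrow> real" where
  "E f = (\<Sum>k\<in>\<Omega>. W k * f k)"

lemma finite_\<Omega>: "finite \<Omega>"
  unfolding \<Omega>_def by (intro finite_PiE) auto

lemma \<Omega>_le: "k \<in> \<Omega> \<Longrightarrow> j < m \<Longrightarrow> k j \<le> L"
  unfolding \<Omega>_def by (auto simp: PiE_iff)

lemma W_pos: "k \<in> \<Omega> \<Longrightarrow> 0 < W k"
  unfolding W_def using \<Omega>_le \<omega>_pos by (intro prod_pos) auto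

lemma E_add: "E (\<lambda>k. f k + g k) = E f + E g"
  by (simp add: E_def distrib_left sum.distrib)

lemma E_diff: "E (\<lambda>k. f k - g k) = E f - E g"
  by (simp add: E_def right_diff_distrib sum_subtractf)

lemma E_cmult: "E (\<lambda>k. c * f k) = c * E f"
  by (simp add: E_def sum_distrib_left mult_ac)

lemma E_sum: "E (\<lambda>k. \<Sum>i\<in>A. f i k) = (\<Sum>i\<in>A. E (f i))"
  unfolding E_def by (subst sum.swap) (simp add: sum_distrib_left)

lemma E_mono: "(\<And>k. k \<in> \<Omega> \<Longrightarrow> f k \<le> g k) \<Longrightarrow> E f \<le> E g"
  unfolding E_def by (intro sum_mono mult_left_mono) (auto intro: less_imp_le W_pos)

lemma E_cong: "(\<And>k. k \<in> \<Omega> \<Longrightarrow> f k = g k) \<Longrightarrow> E f = E g"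
  unfolding E_def by (intro sum.cong) auto

lemma E_nonneg: "(\<And>k. k \<in> \<Omega> \<Longrightarrow> 0 \<le> f k) \<Longrightarrow> 0 \<le> E f"
  using E_mono[of "\<lambda>_. 0" f] by (simp add: E_def)

text \<open>Independence: distributing the product over the sums enumerates the points of
  \<open>\<Omega>\<close>, each with its weight \<open>W\<close>.\<close>

lemma E_prod: "E (\<lambda>k. \<Prod>j<m. g j (k j)) = (\<Prod>j<m. \<Sum>l\<le>L. \<omega> l * g j l)"
  unfolding E_def W_def \<Omega>_def by (subst prod_sum_PiE) (auto simp: prod.distrib)

lemma E_const: "E (\<lambda>k. c) = c"
  using E_prod[of "\<lambda>_ _. 1"] E_cmult[of c "\<lambda>_. 1"] by (simp add: \<omega>_sum)

lemma E_coordinate: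
  assumes "i < m"
  shows "E (\<lambda>k. g (k i)) = (\<Sum>l\<le>L. \<omega> l * g l)"
proof -
  have "E (\<lambda>k. \<Prod>j<m. if j = i then g (k j) else 1)
      = (\<Prod>j<m. if j = i then \<Sum>l\<le>L. \<omega> l * g l else 1)"
    by (subst E_prod[of "\<lambda>j l. if j = i then g l else 1"])
       (intro prod.cong, auto simp: \<omega>_sum)
  then show ?thesis using assms by (simp add: prod.delta)
qed

lemma E_two_coordinates:
  assumes "i < m" "i' < m" "i \<noteq> i'"
  shows "E (\<lambda>k. g (k i) * h (k i')) = (\<Sum>l\<le>L. \<omega> l * g l) * (\<Sum>l\<le>L. \<omega> l * h l)"
proof -
  have split: "(\<Prod>j<m. if j = i then x else if j = i' then y else 1) = x * (y::real)" for x y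
  proof -
    have "(\<Prod>j<m. if j = i then x else if j = i' then y else 1)
        = (\<Prod>j<m. (if j = i then x else 1) * (if j = i' then y else 1))"
      using assms by (intro prod.cong) auto
    then show ?thesis using assms by (simp add: prod.distrib prod.delta)
  qed
  have "E (\<lambda>k. \<Prod>j<m. if j = i then g (k j) else if j = i' then h (k j) else 1)
      = (\<Prod>j<m. if j = i then \<Sum>l\<le>L. \<omega> l * g l else if j = i' then \<Sum>l\<le>L. \<omega> l * h l else 1)"
    by (subst E_prod[of "\<lambda>j l. if j = i then g l else if j = i' then h l else 1"])
       (intro prod.cong, auto simp: \<omega>_sum)
  moreover have "(\<Prod>j<m. if j = i then g (k j) else if j = i' then h (k j) else 1)
      = (\<Prod>j<m. if j = i then g (k i) else if j = i' then h (k i') else 1)" for k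
    by (intro prod.cong) auto
  ultimately show ?thesis by (simp only: split)
qed

lemma E_exp_sum: "E (\<lambda>k. exp (\<Sum>j<m. g j (k j))) = (\<Prod>j<m. \<Sum>l\<le>L. \<omega> l * exp (g j l))"
  by (simp add: exp_sum E_prod[of "\<lambda>j l. exp (g j l)"])

text \<open>The factor \<open>W k powr (1 / r)\<close> turns the counting norm on
  \<open>\<Omega>\<close> into the \<open>L^r\<close>-norm of the probability space, so that a
  random vector becomes a finite family.\<close>

lemma lp_weighted_powr:
  assumes "r > 0"
  shows "lp r \<Omega> (\<lambda>k. W k powr (1 / r) * f k) powr r = E (\<lambda>k. \<bar>f k\<bar> powr r)"
  unfolding lp_powr[OF assms] E_def using assms W_pos
  by (intro sum.cong) (auto simp: abs_mult powr_mult powr_powr less_imp_le)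

lemma lp_weighted:
  assumes "r > 0"
  shows "lp r \<Omega> (\<lambda>k. W k powr (1 / r) * f k) = E (\<lambda>k. \<bar>f k\<bar> powr r) powr (1 / r)"
  unfolding lp_weighted_powr[OF assms, symmetric] using assms by (simp add: powr_powr)

end

subsection \<open>Mixed norms in Banach function spaces\<close>

context banach_function_space
begin

lemma lincomb_closed:
  assumes "finite A" "\<And>i. i \<in> A \<Longrightarrow> z i \<in> X"
  shows "(\<lambda>w. \<Sum>i\<in>A. c i * z i w) \<in> X"
  using assms
proof (induction A rule: finite_induct)
  case (insert i A)
  then have "(\<lambda>w. c i * z i w) \<in> X" "(\<lambda>w. \<Sum>i\<in>A. c i * z i w) \<in> X"
    using scale_closed by auto
  from add_closed[OF this] show ?case using insert by simp
qed (simp add: zero_closed)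

lemma abs_closed:
  assumes "f \<in> X"
  shows "(\<lambda>w. \<bar>f w\<bar>) \<in> X"
proof -
  have [measurable]: "f \<in> borel_measurable M"
    using assms measurable by blast
  show ?thesis by (rule ideal[OF _ assms]) auto
qed

lemma lp_closed:
  assumes "finite B" "1 \<le> t" "\<And>i. i \<in> B \<Longrightarrow> a i \<in> X"
  shows "(\<lambda>w. lp t B (\<lambda>i. a i w)) \<in> X"
proof (rule ideal)
  show "(\<lambda>w. lp t B (\<lambda>i. a i w)) \<in> borel_measurable M"
    using assms(3) measurable by (intro lp_measurable) auto
  have "(\<lambda>w. \<Sum>i\<in>B. 1 * \<bar>a i w\<bar>) \<in> X"
    using assms abs_closed by (intro lincomb_closed) auto
  then show "(\<lambda>w. \<Sum>i\<in>B. \<bar>a i w\<bar>) \<in> X" by simp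
  have "lp t B (\<lambda>i. a i w) \<le> (\<Sum>i\<in>B. \<bar>a i w\<bar>)" for w
    using assms lp_le_sum by blast
  then show "AE w in M. \<bar>lp t B (\<lambda>i. a i w)\<bar> \<le> \<bar>\<Sum>i\<in>B. \<bar>a i w\<bar>\<bar>"
    by (simp add: sum_nonneg)
qed

lemma mixed_closed:
  assumes "finite A" "finite B" "1 \<le> r" "1 \<le> t" "\<And>i j. i \<in> A \<Longrightarrow> j \<in> B \<Longrightarrow> a i j \<in> X"
  shows "(\<lambda>w. lp r A (\<lambda>i. lp t B (\<lambda>j. a i j w))) \<in> X"
  by (rule lp_closed[of A r "\<lambda>i w. lp t B (\<lambda>j. a i j w)"], rule assms, rule assms,
      rule lp_closed[OF assms(2,4)], rule assms)

lemma norm_le_scaled: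
  assumes "f \<in> X" "g \<in> X" "0 \<le> C" "AE w in M. \<bar>f w\<bar> \<le> C * \<bar>g w\<bar>"
  shows "N f \<le> C * N g"
proof -
  have "N f \<le> N (\<lambda>w. C * g w)"
    using assms by (intro norm_lattice scale_closed) (auto simp: abs_mult)
  then show ?thesis using norm_scale assms by simp
qed

end

section \<open>Linear operators and the transfer of mixed-norm bounds\<close>

lemma bounded_operatorD:
  assumes "bounded_operator X NX M' Y NY T"
  shows "f \<in> X \<Longrightarrow> T f \<in> Y"
    and "f \<in> X \<Longrightarrow> g \<in> X \<Longrightarrow> AE w in M'. T (\<lambda>v. f v + g v) w = T f w + T g w"
    and "f \<in> X \<Longrightarrow> AE w in M'. T (\<lambda>v. c * f v) w = c * T f w"
  using assms unfolding bounded_operator_def by simp_all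

lemma bounded_operator_lincomb:
  assumes T: "bounded_operator X NX M' Y NY T" and X: "banach_function_space M X NX"
    and "finite A" "\<And>i. i \<in> A \<Longrightarrow> z i \<in> X"
  shows "AE w in M'. T (\<lambda>v. \<Sum>i\<in>A. c i * z i v) w = (\<Sum>i\<in>A. c i * T (z i) w)"
  using assms(3,4)
proof (induction A rule: finite_induct)
  case empty
  \<comment> \<open>The scalar 0 gives \<open>T 0 = 0\<close> almost everywhere.\<close>
  from bounded_operatorD(3)[OF T banach_function_space.zero_closed[OF X], of 0]
  show ?case by simp
next
  case (insert i A)
  have rest: "(\<lambda>v. \<Sum>i\<in>A. c i * z i v) \<in> X"
    using insert banach_function_space.lincomb_closed[OF X] by blast
  have zi: "z i \<in> X" "(\<lambda>v. c i * z i v) \<in> X"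
    using insert banach_function_space.scale_closed[OF X] by auto
  have "AE w in M'. T (\<lambda>v. c i * z i v + (\<Sum>i\<in>A. c i * z i v)) w
      = T (\<lambda>v. c i * z i v) w + T (\<lambda>v. \<Sum>i\<in>A. c i * z i v) w"
    by (rule bounded_operatorD(2)[OF T zi(2) rest])
  moreover have "AE w in M'. T (\<lambda>v. c i * z i v) w = c i * T (z i) w"
    by (rule bounded_operatorD(3)[OF T zi(1)])
  moreover have "AE w in M'. T (\<lambda>v. \<Sum>i\<in>A. c i * z i v) w = (\<Sum>i\<in>A. c i * T (z i) w)"
    using insert by auto
  ultimately show ?case
    by eventually_elim (simp add: insert.hyps)
qed

text \<open>Condition (ii) with both inner exponents equal to a real \<open>t\<close>. For
  \<open>t = r\<close> it amounts to \<open>r\<close>-regularity; the aim is to reach other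
  \<open>t\<close>.\<close>

definition mixed_bounded ::
    "('a \<Rightarrow> real) set \<Rightarrow> (('a \<Rightarrow> real) \<Rightarrow> real) \<Rightarrow> (('b \<Rightarrow> real) \<Rightarrow> real) \<Rightarrow>
     (('a \<Rightarrow> real) \<Rightarrow> 'b \<Rightarrow> real) \<Rightarrow> real \<Rightarrow> real \<Rightarrow> bool" where
  "mixed_bounded X NX NY T r t \<longleftrightarrow>
     (\<exists>K>0. \<forall>(n::nat) (m::nat) x. (\<forall>i<n. \<forall>j<m. x i j \<in> X) \<longrightarrow>
        NY (\<lambda>w. lp r {..<n} (\<lambda>i. lp t {..<m} (\<lambda>j. T (x i j) w)))
        \<le> K * NX (\<lambda>w. lp r {..<n} (\<lambda>i. lp t {..<m} (\<lambda>j. x i j w))))"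

lemma mixed_bounded_finite:
  fixes T :: "('a \<Rightarrow> real) \<Rightarrow> 'b \<Rightarrow> real"
  assumes "mixed_bounded X NX NY T r t"
  obtains K where "K > 0"
    "\<And>(A :: 'i set) (B :: 'j set) x. finite A \<Longrightarrow> finite B \<Longrightarrow> (\<And>i j. i \<in> A \<Longrightarrow> j \<in> B \<Longrightarrow> x i j \<in> X) \<Longrightarrow>
        NY (\<lambda>w. lp r A (\<lambda>i. lp t B (\<lambda>j. T (x i j) w)))
        \<le> K * NX (\<lambda>w. lp r A (\<lambda>i. lp t B (\<lambda>j. x i j w)))"
proof -
  obtain K where "K > 0" and K: "\<And>(n::nat) (m::nat) x. (\<forall>i<n. \<forall>j<m. x i j \<in> X) \<Longrightarrow>
        NY (\<lambda>w. lp r {..<n} (\<lambda>i. lp t {..<m} (\<lambda>j. T (x i j) w)))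
        \<le> K * NX (\<lambda>w. lp r {..<n} (\<lambda>i. lp t {..<m} (\<lambda>j. x i j w)))"
    using assms unfolding mixed_bounded_def by blast
  have "NY (\<lambda>w. lp r A (\<lambda>i. lp t B (\<lambda>j. T (x i j) w)))
        \<le> K * NX (\<lambda>w. lp r A (\<lambda>i. lp t B (\<lambda>j. x i j w)))"
    if fin: "finite A" "finite B" and X: "\<And>i j. i \<in> A \<Longrightarrow> j \<in> B \<Longrightarrow> x i j \<in> X"
    for A :: "'i set" and B :: "'j set" and x
  proof -
    obtain f where f: "bij_betw f {..<card A} A"
      using ex_bij_betw_nat_finite[OF fin(1)] atLeast0LessThan by metis
    obtain g where g: "bij_betw g {..<card B} B"
      using ex_bij_betw_nat_finite[OF fin(2)] atLeast0LessThan by metis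
    have reindex: "lp r {..<card A} (\<lambda>i. lp t {..<card B} (\<lambda>j. y (f i) (g j)))
        = lp r A (\<lambda>i. lp t B (y i))" for y
      unfolding lp_reindex[OF g, of t "y (f _)"] by (rule lp_reindex[OF f, of r "\<lambda>i. lp t B (y i)"])
    have "\<forall>i<card A. \<forall>j<card B. x (f i) (g j) \<in> X"
      using bij_betwE[OF f] bij_betwE[OF g] X by auto
    from K[OF this] show ?thesis
      by (simp add: reindex[of "\<lambda>i j. T (x i j) _"] reindex[of "\<lambda>i j. x i j _"])
  qed
  with \<open>K > 0\<close> show ?thesis using that by blast
qed

text \<open>Each row \<open>x\<close> is lifted to a matrix \<open>z\<close> whose mixed norm is
  controlled by the \<open>\<ell>^s\<close>-norm of \<open>x\<close> before \<open>T\<close> and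
  controls that of the \<open>T (x j)\<close> after \<open>T\<close>. As \<open>C\<close> does not
  depend on \<open>m\<close>, the old bound for the lifted rows yields the new one with constant
  \<open>C * K * C\<close>. Only existence of \<open>z\<close> is asked, so the lift may be
  nonlinear.\<close>

lemma mixed_bounded_transfer:
  fixes \<Omega> :: "nat \<Rightarrow> 'k set" and B :: "nat \<Rightarrow> 'l set"
  assumes T: "bounded_operator X NX \<nu> Y NY T"
    and X: "banach_function_space \<mu> X NX" and Y: "banach_function_space \<nu> Y NY"
    and "1 \<le> r" "1 \<le> t" "1 \<le> s" "0 < C"
    and bounded: "mixed_bounded X NX NY T r t"
    and fin: "\<And>m. finite (\<Omega> m)" "\<And>m. finite (B m)"
    and lift: "\<And>m x. (\<And>j. j < m \<Longrightarrow> x j \<in> X) \<Longrightarrow> \<exists>z.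
          (\<forall>k\<in>\<Omega> m. \<forall>l\<in>B m. z k l \<in> X) \<and>
          (\<forall>w. lp r (\<Omega> m) (\<lambda>k. lp t (B m) (\<lambda>l. z k l w)) \<le> C * lp s {..<m} (\<lambda>j. x j w)) \<and>
          (AE w in \<nu>. lp s {..<m} (\<lambda>j. T (x j) w)
             \<le> C * lp r (\<Omega> m) (\<lambda>k. lp t (B m) (\<lambda>l. T (z k l) w)))"
  shows "mixed_bounded X NX NY T r s"
proof -
  obtain K where "K > 0" and K: "\<And>(A :: (nat \<times> 'k) set) (B :: 'l set) x. finite A \<Longrightarrow> finite B \<Longrightarrow>
        (\<And>i j. i \<in> A \<Longrightarrow> j \<in> B \<Longrightarrow> x i j \<in> X) \<Longrightarrow>
        NY (\<lambda>w. lp r A (\<lambda>i. lp t B (\<lambda>j. T (x i j) w)))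
        \<le> K * NX (\<lambda>w. lp r A (\<lambda>i. lp t B (\<lambda>j. x i j w)))"
    using mixed_bounded_finite[OF bounded] by blast
  have TX: "T f \<in> Y" if "f \<in> X" for f
    by (rule bounded_operatorD(1)[OF T that])
  have "NY (\<lambda>w. lp r {..<n} (\<lambda>i. lp s {..<m} (\<lambda>j. T (x i j) w)))
      \<le> (C * (K * C)) * NX (\<lambda>w. lp r {..<n} (\<lambda>i. lp s {..<m} (\<lambda>j. x i j w)))"
    if x: "\<forall>i<n. \<forall>j<m. x i j \<in> X" for n m :: nat and x
  proof -
    define P where "P i z \<longleftrightarrow> (\<forall>k\<in>\<Omega> m. \<forall>l\<in>B m. z k l \<in> X) \<and>
          (\<forall>w. lp r (\<Omega> m) (\<lambda>k. lp t (B m) (\<lambda>l. z k l w)) \<le> C * lp s {..<m} (\<lambda>j. x i j w)) \<and>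
          (AE w in \<nu>. lp s {..<m} (\<lambda>j. T (x i j) w)
             \<le> C * lp r (\<Omega> m) (\<lambda>k. lp t (B m) (\<lambda>l. T (z k l) w)))" for i z
    have "\<forall>i\<in>{..<n}. \<exists>z. P i z"
      unfolding P_def using x by (intro ballI lift) auto
    from bchoice[OF this] obtain z where z: "\<And>i. i < n \<Longrightarrow> P i (z i)" by auto
    have zX: "\<And>i k l. i < n \<Longrightarrow> k \<in> \<Omega> m \<Longrightarrow> l \<in> B m \<Longrightarrow> z i k l \<in> X"
      and z_le: "\<And>i w. i < n \<Longrightarrow>
          lp r (\<Omega> m) (\<lambda>k. lp t (B m) (\<lambda>l. z i k l w)) \<le> C * lp s {..<m} (\<lambda>j. x i j w)"
      and Tz: "\<And>i. i < n \<Longrightarrow> AE w in \<nu>. lp s {..<m} (\<lambda>j. T (x i j) w)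
             \<le> C * lp r (\<Omega> m) (\<lambda>k. lp t (B m) (\<lambda>l. T (z i k l) w))"
      using z unfolding P_def by blast+
    \<comment> \<open>The sample points \<open>k\<close> join the outer index, which works because
      the outer norm and the norm over the sample space share the exponent \<open>r\<close>.\<close>
    let ?A = "{..<n} \<times> \<Omega> m"
    let ?z = "\<lambda>(i, k). z i k"
    have fibre: "lp r ?A (\<lambda>a. lp t (B m) (\<lambda>l. h (?z a l))) =
        lp r {..<n} (\<lambda>i. lp r (\<Omega> m) (\<lambda>k. lp t (B m) (\<lambda>l. h (z i k l))))" for h
      using lp_Times[of r "{..<n}" "\<Omega> m" "\<lambda>i k. lp t (B m) (\<lambda>l. h (z i k l))"] \<open>1 \<le> r\<close>
      by (simp add: case_prod_unfold)
    have zA: "?z a l \<in> X" if "a \<in> ?A" "l \<in> B m" for a l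
      using that zX by auto
    have finA: "finite ?A" using fin by auto
    have "NY (\<lambda>w. lp r {..<n} (\<lambda>i. lp s {..<m} (\<lambda>j. T (x i j) w)))
        \<le> C * NY (\<lambda>w. lp r ?A (\<lambda>a. lp t (B m) (\<lambda>l. T (?z a l) w)))"
    proof (rule banach_function_space.norm_le_scaled[OF Y])
      show "(\<lambda>w. lp r {..<n} (\<lambda>i. lp s {..<m} (\<lambda>j. T (x i j) w))) \<in> Y"
        using assms(4-6) x TX by (intro banach_function_space.mixed_closed[OF Y]) auto
      show "(\<lambda>w. lp r ?A (\<lambda>a. lp t (B m) (\<lambda>l. T (?z a l) w))) \<in> Y"
        using assms(4-6) fin zA TX by (intro banach_function_space.mixed_closed[OF Y]) auto
      have "AE w in \<nu>. \<forall>i\<in>{..<n}. lp s {..<m} (\<lambda>j. T (x i j) w)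
             \<le> C * lp r (\<Omega> m) (\<lambda>k. lp t (B m) (\<lambda>l. T (z i k l) w))"
        using Tz by (intro AE_finite_allI) auto
      then show "AE w in \<nu>. \<bar>lp r {..<n} (\<lambda>i. lp s {..<m} (\<lambda>j. T (x i j) w))\<bar>
          \<le> C * \<bar>lp r ?A (\<lambda>a. lp t (B m) (\<lambda>l. T (?z a l) w))\<bar>"
      proof eventually_elim
        case (elim w)
        have "lp r {..<n} (\<lambda>i. lp s {..<m} (\<lambda>j. T (x i j) w))
            \<le> lp r {..<n} (\<lambda>i. C * lp r (\<Omega> m) (\<lambda>k. lp t (B m) (\<lambda>l. T (z i k l) w)))"
          using elim \<open>1 \<le> r\<close> \<open>0 < C\<close> by (intro lp_mono) auto
        then show ?case
          using fibre[of "\<lambda>f. T f w"] \<open>1 \<le> r\<close> \<open>0 < C\<close> by (simp add: lp_scale)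
      qed
    qed (use \<open>0 < C\<close> in auto)
    also have "\<dots> \<le> C * (K * NX (\<lambda>w. lp r ?A (\<lambda>a. lp t (B m) (\<lambda>l. ?z a l w))))"
      using K[OF finA fin(2) zA] \<open>0 < C\<close> by (intro mult_left_mono) auto
    also have "\<dots> \<le> C * (K * (C * NX (\<lambda>w. lp r {..<n} (\<lambda>i. lp s {..<m} (\<lambda>j. x i j w)))))"
    proof (intro mult_left_mono banach_function_space.norm_le_scaled[OF X])
      show "(\<lambda>w. lp r {..<n} (\<lambda>i. lp s {..<m} (\<lambda>j. x i j w))) \<in> X"
        using assms(4-6) x by (intro banach_function_space.mixed_closed[OF X]) auto
      show "(\<lambda>w. lp r ?A (\<lambda>a. lp t (B m) (\<lambda>l. ?z a l w))) \<in> X"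
        using assms(4-6) fin zA by (intro banach_function_space.mixed_closed[OF X]) auto
      have "lp r ?A (\<lambda>a. lp t (B m) (\<lambda>l. ?z a l w))
          \<le> C * lp r {..<n} (\<lambda>i. lp s {..<m} (\<lambda>j. x i j w))" for w
      proof -
        have "lp r {..<n} (\<lambda>i. lp r (\<Omega> m) (\<lambda>k. lp t (B m) (\<lambda>l. z i k l w)))
            \<le> lp r {..<n} (\<lambda>i. C * lp s {..<m} (\<lambda>j. x i j w))"
          using z_le \<open>1 \<le> r\<close> \<open>0 < C\<close> by (intro lp_mono) auto
        then show ?thesis
          using fibre[of "\<lambda>f. f w"] \<open>1 \<le> r\<close> \<open>0 < C\<close> by (simp add: lp_scale)
      qed
      then show "AE w in \<mu>. \<bar>lp r ?A (\<lambda>a. lp t (B m) (\<lambda>l. ?z a l w))\<bar>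
          \<le> C * \<bar>lp r {..<n} (\<lambda>i. lp s {..<m} (\<lambda>j. x i j w))\<bar>"
        by simp
    qed (use \<open>0 < C\<close> \<open>0 < K\<close> in auto)
    finally show ?thesis by (simp add: mult_ac)
  qed
  moreover have "C * (K * C) > 0" using \<open>0 < C\<close> \<open>0 < K\<close> by simp
  ultimately show ?thesis unfolding mixed_bounded_def by blast
qed

text \<open>With inner exponent \<open>r\<close> the mixed norm of a matrix is the
  \<open>\<ell>^r\<close>-norm of all its entries, listed as one family.\<close>

lemma regular_imp_mixed_bounded:
  assumes "regular_operator (ereal r) X NX NY T" "1 \<le> r"
  shows "mixed_bounded X NX NY T r r"
proof -
  obtain K where "K > 0" and K: "\<And>(n::nat) x. (\<forall>i<n. x i \<in> X) \<Longrightarrow>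
        NY (\<lambda>w. lp r {..<n} (\<lambda>i. T (x i) w)) \<le> K * NX (\<lambda>w. lp r {..<n} (\<lambda>i. x i w))"
    using assms(1)[unfolded regular_operator_def ell_ereal] by blast
  have "NY (\<lambda>w. lp r {..<n} (\<lambda>i. lp r {..<m} (\<lambda>j. T (x i j) w)))
        \<le> K * NX (\<lambda>w. lp r {..<n} (\<lambda>i. lp r {..<m} (\<lambda>j. x i j w)))"
    if x: "\<forall>i<n. \<forall>j<m. x i j \<in> X" for n m :: nat and x
  proof -
    let ?A = "{..<n} \<times> {..<m}"
    have "finite ?A" by simp
    from ex_bij_betw_nat_finite[OF this] obtain f where f: "bij_betw f {..<card ?A} ?A"
      by (auto simp: atLeast0LessThan)
    have y: "case_prod x (f i) \<in> X" if "i < card ?A" for i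
    proof -
      have "f i \<in> ?A" using bij_betwE[OF f] that by blast
      then show ?thesis using x by (auto simp: case_prod_unfold)
    qed
    have "NY (\<lambda>w. lp r {..<card ?A} (\<lambda>i. T (case_prod x (f i)) w))
        \<le> K * NX (\<lambda>w. lp r {..<card ?A} (\<lambda>i. case_prod x (f i) w))"
      by (rule K[rule_format, of "card ?A" "\<lambda>i. case_prod x (f i)"]) (rule y)
    moreover have reindex: "lp r {..<card ?A} (\<lambda>i. h (case_prod x (f i)))
        = lp r {..<n} (\<lambda>i. lp r {..<m} (\<lambda>j. h (x i j)))" for h
      unfolding lp_reindex[OF f, of r "\<lambda>a. h (case_prod x a)"]
      using lp_Times[of r "{..<n}" "{..<m}" "\<lambda>i j. h (x i j)"] \<open>1 \<le> r\<close>
      by (simp add: case_prod_unfold)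
    ultimately show ?thesis
      by (simp only: reindex[of "\<lambda>f. T f _"] reindex[of "\<lambda>f. f _"])
  qed
  with \<open>K > 0\<close> show ?thesis unfolding mixed_bounded_def by blast
qed

subsection \<open>Khintchine's inequality\<close>

text \<open>Raise \<open>u \<le> exp u\<close> for \<open>u = x / r\<close> to the power
  \<open>r\<close>. Exponential moments thus control all powers, and they factor over independent
  coordinates.\<close>

lemma powr_le_exp:
  fixes x r :: real
  assumes "0 \<le> x" "0 < r"
  shows "x powr r \<le> r powr r * exp x"
proof -
  have "x / r \<le> exp (x / r)"
    using exp_ge_add_one_self[of "x / r"] by linarith
  then have "(x / r) powr r \<le> exp (x / r) powr r"
    using assms by (intro powr_mono2) auto
  also have "\<dots> = exp x"
    using assms by (simp add: exp_powr_real)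
  finally show ?thesis
    using assms by (simp add: powr_divide field_simps)
qed

text \<open>On \<open>[0, 1]\<close> the bounds \<open>exp x \<le> 1 + x + x\<^sup>2\<close> and
  \<open>exp (- x) \<le> 1 - x + x\<^sup>2\<close> average to \<open>1 + x\<^sup>2\<close>; evenness
  gives the rest.\<close>

lemma exp_symmetric_le:
  fixes x :: real
  assumes "\<bar>x\<bar> \<le> 1"
  shows "(exp x + exp (- x)) / 2 \<le> exp (x\<^sup>2)"
proof -
  have *: "(exp x + exp (- x)) / 2 \<le> exp (x\<^sup>2)" if "0 \<le> x" "x \<le> 1" for x :: real
  proof -
    have "1 + x + x\<^sup>2 / 2 \<le> exp x"
      using that by (simp add: exp_lower_Taylor_quadratic)
    moreover have "1 \<le> (1 - x + x\<^sup>2) * (1 + x + x\<^sup>2 / 2)"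
    proof -
      have "(1 - x + x\<^sup>2) * (1 + x + x\<^sup>2 / 2) = 1 + x\<^sup>2 / 2 + x ^ 3 / 2 + x ^ 4 / 2"
        by (simp add: field_simps power2_eq_square power3_eq_cube power4_eq_xxxx)
      then show ?thesis using that by simp
    qed
    moreover have "0 \<le> 1 - x + x\<^sup>2" using that by simp
    ultimately have "1 \<le> (1 - x + x\<^sup>2) * exp x"
      by (meson mult_left_mono order_trans)
    then have "exp (- x) \<le> 1 - x + x\<^sup>2"
      by (simp add: exp_minus field_simps)
    then have "(exp x + exp (- x)) / 2 \<le> 1 + x\<^sup>2"
      using exp_bound[of x] that by (simp add: field_simps)
    also have "\<dots> \<le> exp (x\<^sup>2)" by (rule exp_ge_add_one_self)
    finally show ?thesis .
  qed
  show ?thesis using *[of x] *[of "- x"] assms by (cases "0 \<le> x") (auto simp: add.commute)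
qed

text \<open>Below \<open>sqrt e\<close> the first term suffices, above \<open>1 / sqrt e\<close> the
  second; in between \<open>x\<^sup>2 \<le> 1 / e\<close> while \<open>x powr r\<close> is at least
  \<open>sqrt e powr r\<close>. It serves to bound a second moment from above by the moment of order
  \<open>r\<close>, up to small multiples of 1 and the fourth moment.\<close>

lemma square_le_interpolated:
  fixes x r e :: real
  assumes "0 \<le> x" "0 < r" "0 < e"
  shows "x\<^sup>2 \<le> e + e * x ^ 4 + (1 / e) * (1 / sqrt e) powr r * x powr r"
proof -
  have nonneg: "0 \<le> (1 / e) * (1 / sqrt e) powr r * x powr r" "0 \<le> e * x ^ 4"
    using assms by auto
  consider "x\<^sup>2 \<le> e" | "1 \<le> e * x\<^sup>2" | "e < x\<^sup>2" "e * x\<^sup>2 < 1" by linarith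
  then show ?thesis
  proof cases
    case 1
    then show ?thesis using nonneg by linarith
  next
    case 2
    have "1 * x\<^sup>2 \<le> e * x\<^sup>2 * x\<^sup>2"
      using 2 by (intro mult_right_mono) auto
    then have "x\<^sup>2 \<le> e * x ^ 4" by (simp add: power2_eq_square power4_eq_xxxx mult_ac)
    then show ?thesis using nonneg assms by linarith
  next
    case 3
    have "sqrt e \<le> x" using 3 assms by (simp add: real_le_lsqrt)
    then have "1 \<le> ((1 / sqrt e) * x) powr r"
      using assms by (intro ge_one_powr_ge_zero) auto
    then have "1 \<le> (1 / sqrt e) powr r * x powr r"
      using assms by (simp add: powr_mult powr_divide)
    then have "(1 / e) * 1 \<le> (1 / e) * ((1 / sqrt e) powr r * x powr r)"
      using assms by (intro mult_left_mono) auto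
    moreover have "x\<^sup>2 \<le> 1 / e" using 3 assms by (simp add: field_simps)
    ultimately have "x\<^sup>2 \<le> (1 / e) * (1 / sqrt e) powr r * x powr r" by (simp add: mult_ac)
    then show ?thesis using nonneg assms by linarith
  qed
qed

text \<open>Levels 0 and 1 of the fair coin space below stand for the signs.\<close>

definition rademacher :: "nat \<Rightarrow> real" where
  "rademacher l = (if l = 0 then 1 else - 1)"

interpretation rademacher: product_weights m 1 "\<lambda>_. 1 / 2" for m
  by unfold_locales auto

abbreviation sign_sum :: "nat \<Rightarrow> (nat \<Rightarrow> real) \<Rightarrow> (nat \<Rightarrow> nat) \<Rightarrow> real" where
  "sign_sum m a k \<equiv> \<Sum>j<m. rademacher (k j) * a j"

lemma lp_2_square: "(lp 2 B a)\<^sup>2 = (\<Sum>i\<in>B. (a i)\<^sup>2)"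
  using lp_powr[of 2 B a] by simp

text \<open>Independence factors the exponential moment into terms \<open>cosh (a j)\<close>, each
  at most \<open>exp ((a j)\<^sup>2)\<close>, and the exponents add up to 1. Normalisation also
  keeps each \<open>a j\<close> in the range of \<open>exp_symmetric_le\<close>.\<close>

lemma rademacher_exp_moment:
  assumes "lp 2 {..<m} a = 1"
  shows "rademacher.E m (\<lambda>k. exp (sign_sum m a k)) \<le> exp 1"
proof -
  have "rademacher.E m (\<lambda>k. exp (sign_sum m a k)) = (\<Prod>j<m. (exp (a j) + exp (- a j)) / 2)"
    by (subst rademacher.E_exp_sum[of m "\<lambda>j l. rademacher l * a j"])
       (simp add: rademacher_def add_divide_distrib add.commute)
  also have "\<dots> \<le> (\<Prod>j<m. exp ((a j)\<^sup>2))"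
  proof (intro prod_mono conjI exp_symmetric_le)
    fix j assume "j \<in> {..<m}"
    then show "\<bar>a j\<bar> \<le> 1" using lp_member[of 2 "{..<m}" j a] assms by auto
  qed (simp add: add_nonneg_nonneg)
  also have "\<dots> = exp 1"
    using lp_2_square[of "{..<m}" a] assms by (simp flip: exp_sum)
  finally show ?thesis .
qed

text \<open>For a sign sum \<open>S\<close>,
  \<open>exp \<bar>S\<bar> \<le> exp S + exp (- S)\<close>, and \<open>- S\<close> is the sign sum
  of \<open>- a\<close>, which has the same norm; hence the factor 2.\<close>

lemma rademacher_moment:
  assumes "lp 2 {..<m} a = 1" "0 < r"
  shows "rademacher.E m (\<lambda>k. \<bar>sign_sum m a k\<bar> powr r) \<le> 2 * r powr r * exp 1"
proof -
  have neg: "sign_sum m (\<lambda>j. - a j) k = - sign_sum m a k" for k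
    by (simp add: sum_negf)
  have "lp 2 {..<m} (\<lambda>j. - a j) = 1"
    using assms(1) lp_cong[of "{..<m}" "\<lambda>j. - a j" a] by simp
  from rademacher_exp_moment[OF this] rademacher_exp_moment[OF assms(1)]
  have exps: "rademacher.E m (\<lambda>k. exp (sign_sum m a k) + exp (- sign_sum m a k)) \<le> 2 * exp 1"
    unfolding rademacher.E_add neg by simp
  have "rademacher.E m (\<lambda>k. \<bar>sign_sum m a k\<bar> powr r)
      \<le> rademacher.E m (\<lambda>k. r powr r * (exp (sign_sum m a k) + exp (- sign_sum m a k)))"
  proof (rule rademacher.E_mono)
    fix k
    have "\<bar>sign_sum m a k\<bar> powr r \<le> r powr r * exp \<bar>sign_sum m a k\<bar>"
      using assms by (intro powr_le_exp) auto
    also have "\<dots> \<le> r powr r * (exp (sign_sum m a k) + exp (- sign_sum m a k))"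
      by (intro mult_left_mono) (auto simp: abs_if)
    finally show "\<bar>sign_sum m a k\<bar> powr r \<le> r powr r * (exp (sign_sum m a k) + exp (- sign_sum m a k))" .
  qed
  also have "\<dots> \<le> r powr r * (2 * exp 1)"
    unfolding rademacher.E_cmult using exps by (intro mult_left_mono) auto
  finally show ?thesis by simp
qed

lemma rademacher_variance: "rademacher.E m (\<lambda>k. (sign_sum m a k)\<^sup>2) = (\<Sum>j<m. (a j)\<^sup>2)"
proof -
  have corr: "rademacher.E m (\<lambda>k. rademacher (k i) * rademacher (k j)) = (if i = j then 1 else 0)"
    if "i < m" "j < m" for i j
  proof (cases "i = j")
    case True
    have "rademacher.E m (\<lambda>k. rademacher (k i) * rademacher (k j)) = rademacher.E m (\<lambda>k. 1)"
      unfolding True by (rule rademacher.E_cong) (simp add: rademacher_def)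
    then show ?thesis unfolding rademacher.E_const using True by simp
  next
    case False
    then show ?thesis
      using rademacher.E_two_coordinates[OF that False, of rademacher rademacher]
      by (simp add: rademacher_def)
  qed
  have "rademacher.E m (\<lambda>k. (sign_sum m a k)\<^sup>2)
      = rademacher.E m (\<lambda>k. \<Sum>i<m. \<Sum>j<m. (a i * a j) * (rademacher (k i) * rademacher (k j)))"
    by (simp add: power2_eq_square sum_product mult_ac)
  also have "\<dots> = (\<Sum>i<m. \<Sum>j<m. (a i * a j) * (if i = j then 1 else 0))"
    unfolding rademacher.E_sum rademacher.E_cmult by (intro sum.cong refl) (simp only: corr lessThan_iff)
  also have "\<dots> = (\<Sum>j<m. (a j)\<^sup>2)"
    by (simp add: power2_eq_square if_distrib[of "\<lambda>x. _ * x"] cong: if_cong)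
  finally show ?thesis .
qed

text \<open>The upper bound is the moment estimate for unit vectors. For the lower bound the
  variance 1 is interpolated between the bounded fourth moment and the moment of order
  \<open>r\<close>.\<close>

lemma khintchine:
  assumes "0 < r"
  obtains C where "0 < C"
    "\<And>m a. lp r (rademacher.\<Omega> m) (\<lambda>k. rademacher.W m k powr (1 / r) * sign_sum m a k)
        \<le> C * lp 2 {..<m} a"
    "\<And>m a. lp 2 {..<m} a
        \<le> C * lp r (rademacher.\<Omega> m) (\<lambda>k. rademacher.W m k powr (1 / r) * sign_sum m a k)"
proof -
  define F where "F m a = lp r (rademacher.\<Omega> m) (\<lambda>k. rademacher.W m k powr (1 / r) * sign_sum m a k)"
    for m a
  have F_scale: "F m (\<lambda>i. c * a i) = \<bar>c\<bar> * F m a" for m c a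
  proof -
    have "sign_sum m (\<lambda>i. c * a i) k = c * sign_sum m a k" for k
      by (simp add: sum_distrib_left mult_ac)
    then show ?thesis
      unfolding F_def lp_scale[OF assms, symmetric] by (simp only: mult.left_commute[of _ c])
  qed
  have F_cong: "F m a = F m b" if "\<And>i. i \<in> {..<m} \<Longrightarrow> a i = b i" for m a b
    unfolding F_def using that by (intro lp_cong) simp
  define C1 where "C1 = (2 * r powr r * exp 1) powr (1 / r)"
  have F_eq: "F m a = rademacher.E m (\<lambda>k. \<bar>sign_sum m a k\<bar> powr r) powr (1 / r)" for m a
    unfolding F_def by (rule rademacher.lp_weighted[OF assms])
  have upper: "F m a \<le> C1 * lp 2 {..<m} a" for m a
  proof (rule lp_bounded_by_normalized[OF _ _ F_scale F_cong])
    fix a :: "nat \<Rightarrow> real" assume "lp 2 {..<m} a = 1"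
    then show "F m a \<le> C1"
      unfolding F_eq C1_def using assms rademacher_moment
      by (intro powr_mono2 rademacher.E_nonneg) auto
  qed auto
  \<comment> \<open>\<open>D\<close> bounds the fourth moment of the sign sum of a unit vector, and
    \<open>e\<close> is chosen so that \<open>e + e * D\<close> is half of the variance 1.\<close>
  define D :: real where "D = 2 * 4 powr 4 * exp 1"
  define e where "e = 1 / (2 * (1 + D))"
  have "D > 0" unfolding D_def by simp
  then have "e > 0" unfolding e_def by simp
  have "e + e * D = e * (1 + D)" by (simp add: algebra_simps)
  also have "\<dots> = 1 / 2" using \<open>D > 0\<close> unfolding e_def by simp
  finally have e: "e + e * D = 1 / 2" .
  define C where "C = (1 / e) * (1 / sqrt e) powr r"
  have "C > 0" unfolding C_def using \<open>e > 0\<close> by simp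
  define C2 where "C2 = (2 * C) powr (1 / r)"
  have lower: "lp 2 {..<m} a \<le> C2 * F m a" for m a
  proof (rule lp_bounds_normalized[OF _ _ _ F_scale])
    fix a :: "nat \<Rightarrow> real" assume unit: "lp 2 {..<m} a = 1"
    have "1 = rademacher.E m (\<lambda>k. \<bar>sign_sum m a k\<bar>\<^sup>2)"
      using rademacher_variance[of m a] lp_2_square[of "{..<m}" a] unit by simp
    also have "\<dots> \<le> rademacher.E m (\<lambda>k. e + e * \<bar>sign_sum m a k\<bar> ^ 4 + C * \<bar>sign_sum m a k\<bar> powr r)"
      unfolding C_def using assms \<open>e > 0\<close>
      by (intro rademacher.E_mono square_le_interpolated) auto
    also have "\<dots> = e + e * rademacher.E m (\<lambda>k. \<bar>sign_sum m a k\<bar> powr 4)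
        + C * rademacher.E m (\<lambda>k. \<bar>sign_sum m a k\<bar> powr r)"
      unfolding rademacher.E_add rademacher.E_cmult rademacher.E_const by simp
    also have "\<dots> \<le> e + e * D + C * rademacher.E m (\<lambda>k. \<bar>sign_sum m a k\<bar> powr r)"
      using rademacher_moment[OF unit, of 4] \<open>e > 0\<close> unfolding D_def by simp
    finally have "1 \<le> 2 * C * rademacher.E m (\<lambda>k. \<bar>sign_sum m a k\<bar> powr r)"
      unfolding e by simp
    then have "1 \<le> (2 * C * rademacher.E m (\<lambda>k. \<bar>sign_sum m a k\<bar> powr r)) powr (1 / r)"
      using assms by (intro ge_one_powr_ge_zero) auto
    also have "\<dots> = C2 * F m a"
      unfolding C2_def F_eq by (rule powr_mult)
    finally show "1 \<le> C2 * F m a" .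
  qed (use \<open>C > 0\<close> in \<open>auto simp: C2_def F_def\<close>)
  have "C1 > 0" "C2 > 0" unfolding C1_def C2_def using \<open>C > 0\<close> assms by auto
  show ?thesis
  proof (rule that[of "C1 + C2"])
    show "0 < C1 + C2" using \<open>C1 > 0\<close> \<open>C2 > 0\<close> by simp
    fix m and a :: "nat \<Rightarrow> real"
    have "F m a \<le> (C1 + C2) * lp 2 {..<m} a"
      using upper[of m a] \<open>C2 > 0\<close> by (simp add: distrib_right add_increasing2)
    then show "lp r (rademacher.\<Omega> m) (\<lambda>k. rademacher.W m k powr (1 / r) * sign_sum m a k)
        \<le> (C1 + C2) * lp 2 {..<m} a" unfolding F_def .
    have "lp 2 {..<m} a \<le> (C1 + C2) * F m a"
      using lower[of m a] \<open>C1 > 0\<close> by (simp add: distrib_right add_increasing F_def)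
    then show "lp 2 {..<m} a
        \<le> (C1 + C2) * lp r (rademacher.\<Omega> m) (\<lambda>k. rademacher.W m k powr (1 / r) * sign_sum m a k)"
      unfolding F_def .
  qed
qed

text \<open>Sign sums embed \<open>\<ell>^2\<close> into \<open>L^r\<close>. The lift consists of
  the sign sums of \<open>x\<close>; the upper Khintchine bound is applied to the
  \<open>x j\<close>, the lower one to the \<open>T (x j)\<close>. The lift is scalar at each sample
  point, hence \<open>B = {0}\<close>.\<close>

lemma mixed_bounded_2:
  assumes T: "bounded_operator X NX \<nu> Y NY T"
    and X: "banach_function_space \<mu> X NX" and Y: "banach_function_space \<nu> Y NY"
    and "1 \<le> r" and bounded: "mixed_bounded X NX NY T r r"
  shows "mixed_bounded X NX NY T r 2"
proof -
  have "0 < r" using \<open>1 \<le> r\<close> by simp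
  obtain C where C: "0 < C"
    "\<And>m a. lp r (rademacher.\<Omega> m) (\<lambda>k. rademacher.W m k powr (1 / r) * sign_sum m a k)
        \<le> C * lp 2 {..<m} a"
    "\<And>m a. lp 2 {..<m} a
        \<le> C * lp r (rademacher.\<Omega> m) (\<lambda>k. rademacher.W m k powr (1 / r) * sign_sum m a k)"
    by (rule khintchine[OF \<open>0 < r\<close>]) (rule that)
  show ?thesis
  proof (rule mixed_bounded_transfer[OF T X Y \<open>1 \<le> r\<close> \<open>1 \<le> r\<close> _ \<open>0 < C\<close> bounded,
        where \<Omega> = rademacher.\<Omega> and B = "\<lambda>_. {0 :: nat}"])
    fix m and x :: "nat \<Rightarrow> 'a \<Rightarrow> real" assume x: "\<And>j. j < m \<Longrightarrow> x j \<in> X"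
    let ?c = "\<lambda>k j. rademacher.W m k powr (1 / r) * rademacher (k j)"
    let ?z = "\<lambda>k (l::nat) w. \<Sum>j<m. ?c k j * x j w"
    have z: "?z k l \<in> X" for k l
      using x by (intro banach_function_space.lincomb_closed[OF X]) auto
    have pull: "(\<Sum>j<m. ?c k j * a j) = rademacher.W m k powr (1 / r) * sign_sum m a k" for k a
      by (simp only: sum_distrib_left mult.assoc)
    have "AE w in \<nu>. \<forall>k\<in>rademacher.\<Omega> m. T (?z k 0) w = (\<Sum>j<m. ?c k j * T (x j) w)"
      using x bounded_operator_lincomb[OF T X, of "{..<m}" x]
      by (intro AE_finite_allI rademacher.finite_\<Omega>) auto
    then have "AE w in \<nu>. lp 2 {..<m} (\<lambda>j. T (x j) w)
        \<le> C * lp r (rademacher.\<Omega> m) (\<lambda>k. lp r {0::nat} (\<lambda>l. T (?z k l) w))"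
    proof eventually_elim
      case (elim w)
      have "lp r (rademacher.\<Omega> m) (\<lambda>k. lp r {0::nat} (\<lambda>l. T (?z k l) w))
          = lp r (rademacher.\<Omega> m) (\<lambda>k. \<Sum>j<m. ?c k j * T (x j) w)"
        using elim \<open>0 < r\<close> by (intro lp_cong) (simp add: lp_sing)
      then show ?case using C(3)[of m "\<lambda>j. T (x j) w"] by (simp add: pull)
    qed
    note Tz = this
    have z_le: "lp r (rademacher.\<Omega> m) (\<lambda>k. lp r {0::nat} (\<lambda>l. ?z k l w)) \<le> C * lp 2 {..<m} (\<lambda>j. x j w)" for w
    proof -
      have "lp r (rademacher.\<Omega> m) (\<lambda>k. lp r {0::nat} (\<lambda>l. ?z k l w))
          = lp r (rademacher.\<Omega> m) (\<lambda>k. \<Sum>j<m. ?c k j * x j w)"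
        using \<open>0 < r\<close> by (intro lp_cong) (simp add: lp_sing)
      then show ?thesis using C(2)[of m "\<lambda>j. x j w"] by (simp add: pull)
    qed
    show "\<exists>z. (\<forall>k\<in>rademacher.\<Omega> m. \<forall>l\<in>{0::nat}. z k l \<in> X) \<and>
          (\<forall>w. lp r (rademacher.\<Omega> m) (\<lambda>k. lp r {0::nat} (\<lambda>l. z k l w)) \<le> C * lp 2 {..<m} (\<lambda>j. x j w)) \<and>
          (AE w in \<nu>. lp 2 {..<m} (\<lambda>j. T (x j) w)
             \<le> C * lp r (rademacher.\<Omega> m) (\<lambda>k. lp r {0::nat} (\<lambda>l. T (z k l) w)))"
    proof (rule exI[of _ ?z], intro conjI ballI allI)
      show "AE w in \<nu>. lp 2 {..<m} (\<lambda>j. T (x j) w)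
        \<le> C * lp r (rademacher.\<Omega> m) (\<lambda>k. lp r {0::nat} (\<lambda>l. T (?z k l) w))"
        by (rule Tz)
    qed (rule z z_le)+
  qed (use rademacher.finite_\<Omega> in auto)
qed

subsection \<open>Pareto weights\<close>

text \<open>Split \<open>(A + y) powr c\<close> as \<open>(A + y) * (A + y) powr (c - 1)\<close>.
  The exponent \<open>c - 1\<close> is nonpositive, so the base \<open>A + y\<close> may be lowered
  to \<open>A\<close>, to \<open>y\<close> or to 1.\<close>

lemma powr_add_le_min:
  fixes A y c :: real
  assumes "1 \<le> A" "0 \<le> y" "c \<le> 1"
  shows "(A + y) powr c \<le> A powr c + min y (y powr c)"
proof (cases "y = 0")
  case False
  with assms have y: "y > 0" by simp
  have split: "x * x powr (c - 1) = x powr c" if "x > 0" for x :: real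
    using that by (simp add: powr_diff)
  have "(A + y) powr c = A * (A + y) powr (c - 1) + y * (A + y) powr (c - 1)"
    using split[of "A + y"] assms y by (simp flip: distrib_right)
  moreover have "A * (A + y) powr (c - 1) \<le> A * A powr (c - 1)"
    using assms y by (intro mult_left_mono powr_mono2') auto
  moreover have "y * (A + y) powr (c - 1) \<le> y * y powr (c - 1)"
    using assms y by (intro mult_left_mono powr_mono2') auto
  moreover have "y * (A + y) powr (c - 1) \<le> y * 1 powr (c - 1)"
    using assms y by (intro mult_left_mono powr_mono2') auto
  ultimately show ?thesis
    using split[of A] split[OF y] assms by simp
qed auto

lemma lp_2_powr_le:
  assumes "finite B" "0 < \<rho>" "\<rho> \<le> 2"
  shows "lp 2 B b powr \<rho> \<le> 1 + (\<Sum>j\<in>B. min ((b j)\<^sup>2) (\<bar>b j\<bar> powr \<rho>))"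
proof -
  have sq: "(x\<^sup>2) powr (\<rho> / 2) = \<bar>x\<bar> powr \<rho>" for x :: real
    by (metis abs_ge_zero field_sum_of_halves mult_2 nonzero_mult_div_cancel_left
        power2_abs powr_numeral powr_powr times_divide_eq_right zero_neq_numeral)
  have "lp 2 B b powr \<rho> = (\<Sum>j\<in>B. (b j)\<^sup>2) powr (\<rho> / 2)"
    using sq[of "lp 2 B b"] by (simp add: lp_2_square)
  \<comment> \<open>The added 1 keeps the base at least 1 throughout the induction, so that small
    coordinates count only quadratically.\<close>
  also have "\<dots> \<le> (1 + (\<Sum>j\<in>B. (b j)\<^sup>2)) powr (\<rho> / 2)"
    using assms by (intro powr_mono2) (auto simp: sum_nonneg)
  also have "\<dots> \<le> 1 + (\<Sum>j\<in>B. min ((b j)\<^sup>2) (\<bar>b j\<bar> powr \<rho>))"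
    using assms(1)
  proof (induction B rule: finite_induct)
    case (insert j B)
    have "(1 + (\<Sum>j\<in>B. (b j)\<^sup>2) + (b j)\<^sup>2) powr (\<rho> / 2)
        \<le> (1 + (\<Sum>j\<in>B. (b j)\<^sup>2)) powr (\<rho> / 2) + min ((b j)\<^sup>2) (((b j)\<^sup>2) powr (\<rho> / 2))"
      using assms by (intro powr_add_le_min) (auto simp: sum_nonneg)
    then show ?case using insert by (simp add: sq add_ac)
  qed simp
  finally show ?thesis .
qed

text \<open>
  A bounded increasing function whose increments over dyadic intervals dominate
  \<open>min t\<^sup>2 t\<^sup>\<rho> \<cdot> t\<^sup>-\<^sup>\<sigma>\<close>, so that sums of the latter over \<open>t = 2\<^sup>l x\<close> telescope.
\<close>

definition logistic :: "real \<Rightarrow> real \<Rightarrow> real" where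
  "logistic c t = t powr c / (1 + t powr c)"

text \<open>The inner minimum is the slower of the decay rates \<open>2 - \<sigma>\<close> at 0 and
  \<open>\<sigma> - \<rho>\<close> at infinity of
  \<open>min (t\<^sup>2) (t powr \<rho>) * t powr (- \<sigma>)\<close>.\<close>

definition dyadic_const :: "real \<Rightarrow> real \<Rightarrow> real" where
  "dyadic_const \<sigma> \<rho> = (let \<kappa> = 2 powr min (2 - \<sigma>) (\<sigma> - \<rho>) in 4 * \<kappa> / (\<kappa> - 1))"

lemma dyadic_const_pos:
  assumes "\<rho> < \<sigma>" "\<sigma> < 2"
  shows "0 < dyadic_const \<sigma> \<rho>"
proof -
  have "1 < 2 powr min (2 - \<sigma>) (\<sigma> - \<rho>)"
    using assms by (intro gr_one_powr) auto
  then show ?thesis by (simp add: dyadic_const_def Let_def)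
qed

text \<open>With \<open>x = t powr c\<close> the left side is at most \<open>min x (1 / x)\<close>,
  hence at most \<open>4 * x / (1 + x)\<^sup>2\<close>, which is comparable to the increment of
  \<open>x / (1 + x)\<close> when \<open>x\<close> is multiplied by \<open>\<kappa>\<close>.\<close>

lemma min_powr_le_logistic_diff:
  assumes "\<rho> < \<sigma>" "\<sigma> < 2" "0 < t"
  defines "c \<equiv> min (2 - \<sigma>) (\<sigma> - \<rho>)"
  shows "min (t\<^sup>2) (t powr \<rho>) * t powr (- \<sigma>) \<le> dyadic_const \<sigma> \<rho> * (logistic c (2 * t) - logistic c t)"
proof -
  define \<kappa> x where "\<kappa> = 2 powr c" and "x = t powr c"
  have "c > 0" using assms by simp
  then have "\<kappa> > 1" unfolding \<kappa>_def by (intro gr_one_powr) auto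
  have "x > 0" unfolding x_def using assms by simp
  have main: "min (t\<^sup>2) (t powr \<rho>) * t powr (- \<sigma>) \<le> 4 * x / (1 + x)\<^sup>2"
  proof (cases "t \<le> 1")
    case True
    have "min (t\<^sup>2) (t powr \<rho>) * t powr (- \<sigma>) \<le> t powr 2 * t powr (- \<sigma>)"
      using assms by (intro mult_right_mono) auto
    also have "\<dots> = t powr (2 - \<sigma>)"
      using powr_add[of t 2 "- \<sigma>"] by simp
    also have "\<dots> \<le> x"
      unfolding x_def using True assms by (intro powr_mono') auto
    also have "x * (1 + x)\<^sup>2 \<le> x * 2\<^sup>2"
      using True \<open>c > 0\<close> \<open>x > 0\<close> assms unfolding x_def
      by (intro mult_left_mono power_mono) (auto intro: powr_le1)
    then have "x \<le> 4 * x / (1 + x)\<^sup>2"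
      using \<open>x > 0\<close> by (simp add: pos_le_divide_eq)
    finally show ?thesis .
  next
    case False
    have "min (t\<^sup>2) (t powr \<rho>) * t powr (- \<sigma>) \<le> t powr \<rho> * t powr (- \<sigma>)"
      using assms by (intro mult_right_mono) auto
    also have "\<dots> = t powr (\<rho> - \<sigma>)"
      using powr_add[of t \<rho> "- \<sigma>"] by simp
    also have "\<dots> \<le> t powr (- c)"
      using False assms by (intro powr_mono) auto
    also have "\<dots> = 1 / x"
      unfolding x_def by (simp add: powr_minus_divide)
    also have "(1 + x)\<^sup>2 \<le> (2 * x)\<^sup>2"
      using False \<open>c > 0\<close> ge_one_powr_ge_zero[of t c] \<open>x > 0\<close> unfolding x_def
      by (intro power_mono) auto
    then have "1 / x \<le> 4 * x / (1 + x)\<^sup>2"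
      using \<open>x > 0\<close> by (simp add: divide_simps power2_eq_square mult_ac)
    finally show ?thesis .
  qed
  also have "\<dots> \<le> 4 * \<kappa> * x / ((1 + \<kappa> * x) * (1 + x))"
  proof -
    have "4 * x * (1 + \<kappa> * x) * (1 + x) \<le> 4 * x * (\<kappa> * (1 + x)) * (1 + x)"
      using \<open>x > 0\<close> \<open>\<kappa> > 1\<close> by (intro mult_left_mono mult_right_mono) (auto simp: algebra_simps)
    moreover have "1 + \<kappa> * x > 0" using \<open>x > 0\<close> \<open>\<kappa> > 1\<close> by (simp add: add_pos_pos)
    ultimately show ?thesis
      using \<open>x > 0\<close> \<open>\<kappa> > 1\<close>
      by (simp add: frac_le_eq divide_le_eq pos_divide_le_eq pos_le_divide_eq power2_eq_square mult_ac)
  qed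
  also have "\<dots> = (4 * \<kappa> / (\<kappa> - 1)) * (\<kappa> * x / (1 + \<kappa> * x) - x / (1 + x))"
  proof -
    have "1 + \<kappa> * x > 0" "1 + x > 0" using \<open>x > 0\<close> \<open>\<kappa> > 1\<close> by (simp_all add: add_pos_pos)
    then have "\<kappa> * x / (1 + \<kappa> * x) - x / (1 + x) = (\<kappa> - 1) * x / ((1 + \<kappa> * x) * (1 + x))"
      by (simp add: diff_frac_eq algebra_simps)
    then show ?thesis using \<open>\<kappa> > 1\<close> by simp
  qed
  also have "\<dots> = dyadic_const \<sigma> \<rho> * (logistic c (2 * t) - logistic c t)"
    unfolding dyadic_const_def logistic_def Let_def \<kappa>_def x_def c_def by (simp add: powr_mult)
  finally show ?thesis .
qed

text \<open>Substituting \<open>t = 2 ^ l * \<bar>x\<bar>\<close> turns the weight into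
  \<open>\<bar>x\<bar> powr \<sigma> * t powr (- \<sigma>)\<close>. The bounds then telescope, with
  total increment at most 1, uniformly in \<open>L\<close>.\<close>

lemma dyadic_sum_le:
  assumes "\<rho> < \<sigma>" "\<sigma> < 2" "0 < \<rho>"
  shows "(\<Sum>l\<le>L. 2 powr (- \<sigma> * real l) * min ((2 ^ l * x)\<^sup>2) (\<bar>2 ^ l * x\<bar> powr \<rho>))
    \<le> dyadic_const \<sigma> \<rho> * \<bar>x\<bar> powr \<sigma>"
proof (cases "x = 0")
  case True
  then show ?thesis by simp
next
  case False
  define c where "c = min (2 - \<sigma>) (\<sigma> - \<rho>)"
  define t where "t l = 2 ^ l * \<bar>x\<bar>" for l :: nat
  have t: "t l > 0" for l unfolding t_def using False by simp
  have "2 powr (- \<sigma> * real l) * min ((2 ^ l * x)\<^sup>2) (\<bar>2 ^ l * x\<bar> powr \<rho>)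
      \<le> \<bar>x\<bar> powr \<sigma> * (dyadic_const \<sigma> \<rho> * (logistic c (t (Suc l)) - logistic c (t l)))" for l
  proof -
    have "2 powr (- \<sigma> * real l) = (2 ^ l) powr (- \<sigma>)"
      by (simp add: powr_powr mult.commute flip: powr_realpow)
    also have "\<dots> = \<bar>x\<bar> powr \<sigma> * t l powr (- \<sigma>)"
      unfolding t_def using False by (simp add: powr_mult powr_minus)
    finally have "2 powr (- \<sigma> * real l) * min ((2 ^ l * x)\<^sup>2) (\<bar>2 ^ l * x\<bar> powr \<rho>)
        = \<bar>x\<bar> powr \<sigma> * (min ((t l)\<^sup>2) (t l powr \<rho>) * t l powr (- \<sigma>))"
      by (simp add: t_def abs_mult power_mult_distrib)
    then show ?thesis
      using min_powr_le_logistic_diff[OF assms(1,2) t, of l]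
      by (simp add: c_def t_def mult_left_mono mult.assoc)
  qed
  then have "(\<Sum>l\<le>L. 2 powr (- \<sigma> * real l) * min ((2 ^ l * x)\<^sup>2) (\<bar>2 ^ l * x\<bar> powr \<rho>))
      \<le> (\<Sum>l\<le>L. \<bar>x\<bar> powr \<sigma> * (dyadic_const \<sigma> \<rho> * (logistic c (t (Suc l)) - logistic c (t l))))"
    by (rule sum_mono)
  also have "\<dots> = \<bar>x\<bar> powr \<sigma> * (dyadic_const \<sigma> \<rho> * (logistic c (t (Suc L)) - logistic c (t 0)))"
    using sum_lessThan_telescope[of "\<lambda>l. logistic c (t l)" "Suc L"]
    by (simp add: lessThan_Suc_atMost flip: sum_distrib_left)
  also have "\<dots> \<le> \<bar>x\<bar> powr \<sigma> * (dyadic_const \<sigma> \<rho> * 1)"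
  proof (intro mult_left_mono)
    have "logistic c (t (Suc L)) \<le> 1" "0 \<le> logistic c (t 0)"
      unfolding logistic_def by (simp_all add: divide_le_eq_1 add_pos_nonneg)
    then show "logistic c (t (Suc L)) - logistic c (t 0) \<le> 1" by linarith
  qed (use dyadic_const_pos[OF assms(1,2)] in auto)
  finally show ?thesis by (simp add: mult.commute)
qed

section \<open>A truncated Pareto law and the embedding of \<open>\<ell>^\<sigma>\<close> into
  \<open>L^\<rho>(\<ell>^2)\<close>\<close>

locale pareto_weights =
  fixes m :: nat and \<sigma> :: real
  assumes \<sigma>: "1 < \<sigma>" "\<sigma> < 2"
begin

text \<open>
  Truncation of the heavy tail keeps the space finite; \<open>m\<close> times the mass of the top level is
  at most \<open>1 / 2\<close>, so it costs only a constant.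
\<close>

abbreviation top_level :: nat where
  "top_level \<equiv> Suc m"

definition \<omega> :: "nat \<Rightarrow> real" where
  "\<omega> l = 2 powr (- \<sigma> * real l) / (\<Sum>l\<le>top_level. 2 powr (- \<sigma> * real l))"

lemma geometric_le: "2 powr (- \<sigma> * real l) \<le> (1 / 2) ^ l"
proof -
  have "2 powr (- \<sigma> * real l) \<le> 2 powr (- real l)"
    using \<sigma> by (intro powr_mono) (auto intro: mult_le_cancel_right1[THEN iffD2])
  then show ?thesis by (simp add: powr_minus powr_realpow power_one_over inverse_eq_divide)
qed

text \<open>This control of the normalising constant makes \<open>\<omega> l\<close> agree with
  \<open>2 powr (- \<sigma> * real l)\<close> up to a factor 2.\<close>

lemma weight_total:
  "1 \<le> (\<Sum>l\<le>top_level. 2 powr (- \<sigma> * real l))" "(\<Sum>l\<le>top_level. 2 powr (- \<sigma> * real l)) \<le> 2"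
proof -
  have "(\<Sum>l\<in>{0}. 2 powr (- \<sigma> * real l)) \<le> (\<Sum>l\<le>top_level. 2 powr (- \<sigma> * real l))"
    by (intro sum_mono2) auto
  then show "1 \<le> (\<Sum>l\<le>top_level. 2 powr (- \<sigma> * real l))" by simp
  have "(\<Sum>l\<le>top_level. 2 powr (- \<sigma> * real l)) \<le> (\<Sum>l\<le>top_level. (1 / 2) ^ l)"
    by (intro sum_mono geometric_le)
  also have "\<dots> \<le> 2" by (subst sum_gp0) (auto simp: field_simps)
  finally show "(\<Sum>l\<le>top_level. 2 powr (- \<sigma> * real l)) \<le> 2" .
qed

lemma \<omega>_le: "\<omega> l \<le> 2 powr (- \<sigma> * real l)"
  unfolding \<omega>_def using weight_total by (simp add: divide_le_eq mult_le_cancel_left1)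

lemma \<omega>_ge: "2 powr (- \<sigma> * real l) / 2 \<le> \<omega> l"
  unfolding \<omega>_def using weight_total by (intro divide_left_mono) auto

lemma \<omega>_positive: "0 < \<omega> l"
  by (rule less_le_trans[OF _ \<omega>_ge]) simp

sublocale product_weights m top_level \<omega>
proof
  show "(\<Sum>l\<le>top_level. \<omega> l) = 1"
    using weight_total unfolding \<omega>_def by (simp flip: sum_divide_distrib)
qed (rule \<omega>_positive)

lemma top_level_weight: "real m * 2 powr (- \<sigma> * real top_level) \<le> 1 / 2"
proof -
  have "real m * 2 powr (- \<sigma> * real top_level) \<le> real m * (1 / 2) ^ top_level"
    by (intro mult_left_mono geometric_le) auto
  also have "\<dots> \<le> 2 ^ m * (1 / 2) ^ top_level"
    by (intro mult_right_mono) (auto simp: of_nat_less_two_power less_imp_le)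
  also have "\<dots> = 1 / 2" by (simp add: power_one_over)
  finally show ?thesis .
qed

text \<open>The power of the norm is at most 1 plus a sum of functions of single coordinates. Their
  means are dyadic sums of order \<open>\<bar>a j\<bar> powr \<sigma>\<close>, which add up to a
  constant for a unit vector.\<close>

lemma moment_le:
  assumes "0 < \<rho>" "\<rho> < \<sigma>" "lp \<sigma> {..<m} a = 1"
  shows "E (\<lambda>k. lp 2 {..<m} (\<lambda>j. 2 ^ k j * a j) powr \<rho>) \<le> 1 + dyadic_const \<sigma> \<rho>"
proof -
  let ?g = "\<lambda>j l. min ((2 ^ l * a j)\<^sup>2) (\<bar>2 ^ l * a j\<bar> powr \<rho>)"
  have "E (\<lambda>k. lp 2 {..<m} (\<lambda>j. 2 ^ k j * a j) powr \<rho>) \<le> E (\<lambda>k. 1 + (\<Sum>j<m. ?g j (k j)))"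
    using assms \<sigma> by (intro E_mono lp_2_powr_le) auto
  also have "\<dots> = 1 + (\<Sum>j<m. \<Sum>l\<le>top_level. \<omega> l * ?g j l)"
    unfolding E_add E_const E_sum
    by (intro arg_cong2[of _ _ _ _ "(+)"] sum.cong refl E_coordinate) simp
  also have "\<dots> \<le> 1 + (\<Sum>j<m. dyadic_const \<sigma> \<rho> * \<bar>a j\<bar> powr \<sigma>)"
  proof (intro add_left_mono sum_mono)
    fix j
    have "(\<Sum>l\<le>top_level. \<omega> l * ?g j l) \<le> (\<Sum>l\<le>top_level. 2 powr (- \<sigma> * real l) * ?g j l)"
      by (intro sum_mono mult_right_mono \<omega>_le) auto
    also have "\<dots> \<le> dyadic_const \<sigma> \<rho> * \<bar>a j\<bar> powr \<sigma>"
      using assms \<sigma> by (intro dyadic_sum_le) auto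
    finally show "(\<Sum>l\<le>top_level. \<omega> l * ?g j l) \<le> dyadic_const \<sigma> \<rho> * \<bar>a j\<bar> powr \<sigma>" .
  qed
  also have "\<dots> = 1 + dyadic_const \<sigma> \<rho>"
    using lp_powr[of \<sigma> "{..<m}" a] assms \<sigma> by (simp flip: sum_distrib_left)
  finally show ?thesis .
qed

text \<open>The events \<open>1 / 2 \<le> 2 ^ k j * \<bar>a j\<bar>\<close> are independent with
  total probability at least 1 / 4. So with probability at least \<open>1 - exp (- (1 / 4))\<close>
  one of them occurs, and then the norm is at least 1 / 2.\<close>

lemma moment_ge:
  assumes "0 < \<rho>" "lp \<sigma> {..<m} a = 1"
  shows "2 powr (- \<rho>) * (1 - exp (- (1 / 4))) \<le> E (\<lambda>k. lp 2 {..<m} (\<lambda>j. 2 ^ k j * a j) powr \<rho>)"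
proof -
  define miss :: "nat \<Rightarrow> nat \<Rightarrow> real" where "miss j l = (if 1 / 2 \<le> 2 ^ l * \<bar>a j\<bar> then 0 else 1)" for j l
  define p where "p j = (\<Sum>l\<le>top_level. \<omega> l * (1 - miss j l))" for j
  let ?\<delta> = "2 powr (- \<sigma> * real top_level)"
  \<comment> \<open>The subtracted term covers coordinates so small that not even the top level
    lifts them to 1 / 2.\<close>
  have p_ge: "\<bar>a j\<bar> powr \<sigma> / 2 - ?\<delta> / 2 \<le> p j" if "j < m" for j
  proof (cases "1 / 2 \<le> 2 ^ top_level * \<bar>a j\<bar>")
    case False
    have "\<bar>a j\<bar> \<le> 2 powr (- real top_level)"
      using False by (simp add: powr_minus powr_realpow field_simps del: power_Suc of_nat_Suc)
    then have "\<bar>a j\<bar> powr \<sigma> \<le> (2 powr (- real top_level)) powr \<sigma>"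
      using \<sigma> by (intro powr_mono2) auto
    moreover have "0 \<le> p j"
      unfolding p_def miss_def using \<omega>_positive by (intro sum_nonneg) (auto simp: less_imp_le)
    moreover have "(2 powr (- real top_level)) powr \<sigma> = ?\<delta>"
      by (simp add: powr_powr mult.commute del: of_nat_Suc)
    ultimately show ?thesis by linarith
  next
    case True
    \<comment> \<open>At the least level reaching 1 / 2 the product is still at most 1: one level
      lower it was below 1 / 2, and at level 0 it is an entry of a unit vector. Hence the weight of
      this level is at least \<open>\<bar>a j\<bar> powr \<sigma> / 2\<close>.\<close>
    define l where "l = (LEAST l. 1 / 2 \<le> 2 ^ l * \<bar>a j\<bar>)"
    have l: "1 / 2 \<le> 2 ^ l * \<bar>a j\<bar>" "l \<le> top_level"
      unfolding l_def
      by (rule LeastI[of "\<lambda>l. 1 / 2 \<le> 2 ^ l * \<bar>a j\<bar>", OF True],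
          rule Least_le[of "\<lambda>l. 1 / 2 \<le> 2 ^ l * \<bar>a j\<bar>", OF True])
    have "2 ^ l * \<bar>a j\<bar> \<le> 1"
    proof (cases l)
      case 0
      then show ?thesis using lp_member[of \<sigma> "{..<m}" j a] assms \<sigma> that by simp
    next
      case (Suc l')
      then have "\<not> 1 / 2 \<le> 2 ^ l' * \<bar>a j\<bar>"
        using not_less_Least[of l' "\<lambda>l. 1 / 2 \<le> 2 ^ l * \<bar>a j\<bar>"] unfolding l_def by simp
      then show ?thesis unfolding Suc by simp
    qed
    then have "\<bar>a j\<bar> \<le> 2 powr (- real l)"
      by (simp add: powr_minus powr_realpow field_simps)
    then have "\<bar>a j\<bar> powr \<sigma> \<le> (2 powr (- real l)) powr \<sigma>"
      using \<sigma> by (intro powr_mono2) auto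
    then have "\<bar>a j\<bar> powr \<sigma> / 2 \<le> \<omega> l * (1 - miss j l)"
      using l \<omega>_ge[of l] by (simp add: miss_def powr_powr mult.commute)
    also have "\<dots> \<le> p j"
      unfolding p_def using l \<omega>_positive by (intro member_le_sum) (auto simp: miss_def less_imp_le)
    finally show ?thesis using powr_ge_zero[of 2 "- \<sigma> * real top_level"] by linarith
  qed
  \<comment> \<open>The unit norm contributes 1 / 2, and truncation costs \<open>m\<close> times
    \<open>?\<delta> / 2\<close>, at most 1 / 4.\<close>
  have "1 / 4 \<le> (\<Sum>j<m. \<bar>a j\<bar> powr \<sigma> / 2 - ?\<delta> / 2)"
    using lp_powr[of \<sigma> "{..<m}" a] assms \<sigma> top_level_weight
    by (simp add: sum_subtractf flip: sum_divide_distrib)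
  also have "\<dots> \<le> (\<Sum>j<m. p j)"
    using p_ge by (intro sum_mono) auto
  finally have sum_p: "1 / 4 \<le> (\<Sum>j<m. p j)" .
  have "E (\<lambda>k. \<Prod>j<m. miss j (k j)) = (\<Prod>j<m. 1 - p j)"
    unfolding E_prod p_def right_diff_distrib sum_subtractf using \<omega>_sum by simp
  also have "\<dots> \<le> (\<Prod>j<m. exp (- p j))"
  proof (intro prod_mono conjI)
    fix j
    have "p j \<le> (\<Sum>l\<le>top_level. \<omega> l * 1)"
      unfolding p_def using \<omega>_positive by (intro sum_mono mult_left_mono) (auto simp: miss_def less_imp_le)
    then show "0 \<le> 1 - p j" using \<omega>_sum by simp
    show "1 - p j \<le> exp (- p j)" using exp_ge_add_one_self[of "- p j"] by simp
  qed
  also have "\<dots> \<le> exp (- (1 / 4))"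
    using sum_p by (simp add: sum_negf flip: exp_sum)
  finally have "2 powr (- \<rho>) * (1 - exp (- (1 / 4))) \<le> 2 powr (- \<rho>) * (1 - E (\<lambda>k. \<Prod>j<m. miss j (k j)))"
    by simp
  also have "\<dots> = E (\<lambda>k. 2 powr (- \<rho>) * (1 - (\<Prod>j<m. miss j (k j))))"
    unfolding E_cmult E_diff E_const ..
  also have "\<dots> \<le> E (\<lambda>k. lp 2 {..<m} (\<lambda>j. 2 ^ k j * a j) powr \<rho>)"
  proof (rule E_mono)
    fix k
    show "2 powr (- \<rho>) * (1 - (\<Prod>j<m. miss j (k j))) \<le> lp 2 {..<m} (\<lambda>j. 2 ^ k j * a j) powr \<rho>"
    proof (cases "\<exists>j<m. 1 / 2 \<le> 2 ^ k j * \<bar>a j\<bar>")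
      case True
      then obtain j where j: "j < m" "1 / 2 \<le> 2 ^ k j * \<bar>a j\<bar>" by blast
      have "1 / 2 \<le> lp 2 {..<m} (\<lambda>j. 2 ^ k j * a j)"
        using lp_member[of 2 "{..<m}" j "\<lambda>j. 2 ^ k j * a j"] j by (simp add: abs_mult)
      then have "(1 / 2) powr \<rho> \<le> lp 2 {..<m} (\<lambda>j. 2 ^ k j * a j) powr \<rho>"
        using assms by (intro powr_mono2) auto
      moreover have miss: "(\<Prod>j<m. miss j (k j)) = 0"
        using j by (intro prod_zero) (auto simp: miss_def)
      ultimately show ?thesis unfolding miss by (simp add: powr_minus_divide powr_divide)
    next
      case False
      then have "(\<Prod>j<m. miss j (k j)) = 1"
        by (intro prod.neutral) (auto simp: miss_def)
      then show ?thesis by simp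
    qed
  qed
  finally show ?thesis .
qed

text \<open>The \<open>L^\<rho>(\<ell>^2)\<close>-norm of the random vector
  \<open>2 ^ k j * a j\<close>, with the probability weights moved inside so that all entries are
  scalar multiples of the \<open>a j\<close>.\<close>

definition scaled_norm :: "real \<Rightarrow> (nat \<Rightarrow> real) \<Rightarrow> real" where
  "scaled_norm \<rho> a = lp \<rho> \<Omega> (\<lambda>k. lp 2 {..<m} (\<lambda>j. W k powr (1 / \<rho>) * 2 ^ k j * a j))"

lemma scaled_norm_eq:
  assumes "0 < \<rho>"
  shows "scaled_norm \<rho> a = E (\<lambda>k. lp 2 {..<m} (\<lambda>j. 2 ^ k j * a j) powr \<rho>) powr (1 / \<rho>)"
proof -
  have "scaled_norm \<rho> a = lp \<rho> \<Omega> (\<lambda>k. W k powr (1 / \<rho>) * lp 2 {..<m} (\<lambda>j. 2 ^ k j * a j))"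
    unfolding scaled_norm_def mult.assoc by (simp add: lp_scale)
  then show ?thesis by (simp add: lp_weighted[OF assms])
qed

lemma scaled_norm_scale:
  assumes "0 < \<rho>"
  shows "scaled_norm \<rho> (\<lambda>j. c * a j) = \<bar>c\<bar> * scaled_norm \<rho> a"
  using assms unfolding scaled_norm_def mult.left_commute[of _ c] by (simp add: lp_scale)

lemma scaled_norm_cong:
  assumes "\<And>j. j \<in> {..<m} \<Longrightarrow> a j = b j"
  shows "scaled_norm \<rho> a = scaled_norm \<rho> b"
proof -
  have "lp 2 {..<m} (\<lambda>j. W k powr (1 / \<rho>) * 2 ^ k j * a j)
      = lp 2 {..<m} (\<lambda>j. W k powr (1 / \<rho>) * 2 ^ k j * b j)" for k
    using assms by (intro lp_cong) simp
  then show ?thesis unfolding scaled_norm_def by simp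
qed

lemma scaled_norm_le:
  assumes "0 < \<rho>" "\<rho> < \<sigma>"
  shows "scaled_norm \<rho> a \<le> (1 + dyadic_const \<sigma> \<rho>) powr (1 / \<rho>) * lp \<sigma> {..<m} a"
proof (rule lp_bounded_by_normalized[OF _ _ scaled_norm_scale scaled_norm_cong])
  fix a assume "lp \<sigma> {..<m} a = 1"
  then show "scaled_norm \<rho> a \<le> (1 + dyadic_const \<sigma> \<rho>) powr (1 / \<rho>)"
    unfolding scaled_norm_eq[OF assms(1)] using assms moment_le
    by (intro powr_mono2 E_nonneg) auto
qed (use assms \<sigma> in auto)

text \<open>The constant is the reciprocal of the root of order \<open>\<rho>\<close> of the bound
  in \<open>moment_ge\<close>.\<close>

lemma le_scaled_norm:
  assumes "0 < \<rho>"
  shows "lp \<sigma> {..<m} a \<le> (2 / (1 - exp (- (1 / 4))) powr (1 / \<rho>)) * scaled_norm \<rho> a"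
proof (rule lp_bounds_normalized[OF _ _ _ scaled_norm_scale])
  fix a assume unit: "lp \<sigma> {..<m} a = 1"
  let ?c = "1 - exp (- (1 / 4)) :: real"
  have "?c > 0" by simp
  have "1 = (2 / ?c powr (1 / \<rho>)) * (2 powr (- \<rho>) * ?c) powr (1 / \<rho>)"
    using assms \<open>?c > 0\<close> by (simp add: powr_mult powr_powr powr_neg_one)
  also have "\<dots> \<le> (2 / ?c powr (1 / \<rho>)) * scaled_norm \<rho> a"
    unfolding scaled_norm_eq[OF assms] using assms moment_ge[OF assms unit] \<open>?c > 0\<close>
    by (intro mult_left_mono powr_mono2) auto
  finally show "1 \<le> (2 / ?c powr (1 / \<rho>)) * scaled_norm \<rho> a" .
qed (use assms \<sigma> in \<open>auto simp: scaled_norm_def\<close>)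

end

text \<open>With \<open>\<sigma> = s\<close> and \<open>\<rho> = r\<close> the Pareto weights embed
  \<open>\<ell>^s\<close> into \<open>L^r(\<ell>^2)\<close>. The lift multiplies each
  \<open>x l\<close> by scalars; the upper norm bound serves before \<open>T\<close>, the lower one
  after it.\<close>

lemma mixed_bounded_below_2:
  assumes T: "bounded_operator X NX \<nu> Y NY T"
    and X: "banach_function_space \<mu> X NX" and Y: "banach_function_space \<nu> Y NY"
    and "1 \<le> r" "r < s" "s < 2" and bounded: "mixed_bounded X NX NY T r 2"
  shows "mixed_bounded X NX NY T r s"
proof -
  have weights: "pareto_weights s"
    using assms by unfold_locales auto
  interpret pareto_weights m s for m
    by (rule weights)
  define C where "C = (1 + dyadic_const s r) powr (1 / r) + 2 / (1 - exp (- (1 / 4))) powr (1 / r)"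
  have parts: "0 < (1 + dyadic_const s r) powr (1 / r)" "0 \<le> 2 / (1 - exp (- (1 / 4)) :: real) powr (1 / r)"
    using dyadic_const_pos[of r s] assms by auto
  then have "C > 0" unfolding C_def by linarith
  have upper: "scaled_norm m r a \<le> C * lp s {..<m} a" for m a
    using scaled_norm_le[of r m a] parts assms
    by (simp add: C_def distrib_right add_increasing2 del: powr_gt_zero)
  have lower: "lp s {..<m} a \<le> C * scaled_norm m r a" for m a
    using le_scaled_norm[of r m a] parts assms
    by (simp add: C_def distrib_right add_increasing scaled_norm_def del: powr_gt_zero)
  show ?thesis
  proof (rule mixed_bounded_transfer[OF T X Y \<open>1 \<le> r\<close> _ _ \<open>C > 0\<close> bounded,
        where \<Omega> = \<Omega> and B = "\<lambda>m. {..<m}"])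
    fix m and x :: "nat \<Rightarrow> 'a \<Rightarrow> real" assume x: "\<And>j. j < m \<Longrightarrow> x j \<in> X"
    let ?z = "\<lambda>k (l::nat) w. (W m k powr (1 / r) * 2 ^ k l) * x l w"
    have z: "?z k l \<in> X" if "l < m" for k l
      using x[OF that] by (rule banach_function_space.scale_closed[OF X])
    have "AE w in \<nu>. \<forall>k\<in>\<Omega> m. \<forall>l\<in>{..<m}. T (?z k l) w = (W m k powr (1 / r) * 2 ^ k l) * T (x l) w"
      using x bounded_operatorD(3)[OF T] by (intro AE_finite_allI finite_\<Omega>) auto
    then have Tz: "AE w in \<nu>. lp s {..<m} (\<lambda>j. T (x j) w)
        \<le> C * lp r (\<Omega> m) (\<lambda>k. lp 2 {..<m} (\<lambda>l. T (?z k l) w))"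
    proof eventually_elim
      case (elim w)
      have "lp 2 {..<m} (\<lambda>l. T (?z k l) w)
          = lp 2 {..<m} (\<lambda>l. (W m k powr (1 / r) * 2 ^ k l) * T (x l) w)" if "k \<in> \<Omega> m" for k
        using elim that by (intro lp_cong) auto
      then have "lp r (\<Omega> m) (\<lambda>k. lp 2 {..<m} (\<lambda>l. T (?z k l) w)) = scaled_norm m r (\<lambda>j. T (x j) w)"
        unfolding scaled_norm_def by (intro lp_cong) simp
      then show ?case using lower[of m "\<lambda>j. T (x j) w"] by simp
    qed
    show "\<exists>z. (\<forall>k\<in>\<Omega> m. \<forall>l\<in>{..<m}. z k l \<in> X) \<and>
          (\<forall>w. lp r (\<Omega> m) (\<lambda>k. lp 2 {..<m} (\<lambda>l. z k l w)) \<le> C * lp s {..<m} (\<lambda>j. x j w)) \<and>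
          (AE w in \<nu>. lp s {..<m} (\<lambda>j. T (x j) w)
             \<le> C * lp r (\<Omega> m) (\<lambda>k. lp 2 {..<m} (\<lambda>l. T (z k l) w)))"
    proof (rule exI[of _ ?z], intro conjI ballI allI)
      show "AE w in \<nu>. lp s {..<m} (\<lambda>j. T (x j) w)
        \<le> C * lp r (\<Omega> m) (\<lambda>k. lp 2 {..<m} (\<lambda>l. T (?z k l) w))"
        by (rule Tz)
    qed (use z upper in \<open>auto simp: scaled_norm_def\<close>)
  qed (use assms finite_\<Omega> in auto)
qed

subsection \<open>The dual construction\<close>

text \<open>Young's inequality with coarser constants. Either \<open>y \<le> x powr (r - 1)\<close>,
  or \<open>x \<le> y powr (1 / (r - 1))\<close>; substituting gives one of the two powers.\<close>

lemma mult_le_powr_conjugate: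
  fixes x y r \<rho> :: real
  assumes "0 \<le> x" "0 \<le> y" "1 < r" "\<rho> = r / (r - 1)"
  shows "x * y \<le> x powr r + y powr \<rho>"
proof (cases "x = 0 \<or> y = 0")
  case False
  with assms have pos: "x > 0" "y > 0" by auto
  show ?thesis
  proof (cases "y \<le> x powr (r - 1)")
    case True
    then have "x * y \<le> x powr 1 * x powr (r - 1)" using pos by simp
    also have "\<dots> = x powr r" using pos by (simp add: powr_diff)
    finally show ?thesis by (simp add: add_increasing2)
  next
    case False
    have "x = (x powr (r - 1)) powr (1 / (r - 1))"
      using pos assms by (simp add: powr_powr)
    also have "\<dots> \<le> y powr (1 / (r - 1))"
      using False pos assms by (intro powr_mono2) auto
    finally have "x * y \<le> y powr (1 / (r - 1)) * y powr 1" using pos by simp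
    also have "\<dots> = y powr (1 / (r - 1) + 1)" by (rule powr_add[symmetric])
    also have "1 / (r - 1) + 1 = \<rho>"
      unfolding assms(4) using assms(3) by (simp add: field_simps)
    finally show ?thesis by (simp add: add_increasing)
  qed
qed auto

text \<open>The exponent of the weights is conjugate to \<open>s\<close> and lies between
  \<open>r / (r - 1)\<close> and 2. The adjoint of the embedding of \<open>\<ell>^\<sigma>\<close>
  then maps \<open>L^r(\<ell>^2)\<close> onto \<open>\<ell>^s\<close>, and \<open>lift\<close> will
  be a bounded right inverse.\<close>

locale pareto_dual = pareto_weights +
  fixes s r :: real
  assumes s: "2 < s" "s < r" and conjugate: "\<sigma> = s / (s - 1)"
begin

text \<open>
  \<open>2\<^sup>l\<close> with \<open>l = level t\<close> is the scale of \<open>t powr - (s - 1)\<close>; in the lift below, this makes both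
  the quotients \<open>a j / (\<omega> l * 2 ^ l)\<close> bounded and the events \<open>k j = l\<close> of total probability \<open>O(1)\<close>.
  The value at \<open>t = 0\<close> is irrelevant, because there the lift is \<open>0\<close> anyway.
\<close>

definition level :: "real \<Rightarrow> nat" where
  "level t = min top_level (nat \<lfloor>(s - 1) * (- log 2 t)\<rfloor>)"

text \<open>Coordinate \<open>j\<close> is sampled only at the level fitting its relative size and
  divided by the probability of that level, so its mean against \<open>2 ^ k j\<close> is exact. The
  map is homogeneous but not linear.\<close>

definition lift :: "(nat \<Rightarrow> real) \<Rightarrow> (nat \<Rightarrow> nat) \<Rightarrow> nat \<Rightarrow> real" where
  "lift a k j =
     (if k j = level (\<bar>a j\<bar> / lp s {..<m} a) then a j / (\<omega> (k j) * 2 ^ k j) else 0)"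

lemma conjugate_simps: "(s - 1) * (\<sigma> - 1) = 1" "(s - 1) * \<sigma> = s"
  using s unfolding conjugate by (auto simp: field_simps)

lemma level_le: "level t \<le> top_level"
  unfolding level_def by simp

text \<open>Rounding the logarithm down loses a factor of at most 2; the lower bound can fail only
  where the level was truncated.\<close>

lemma level_bounds:
  assumes "0 < t" "t \<le> 1"
  shows "t powr (s - 1) \<le> 2 powr (- real (level t))"
    and "level t = top_level \<or> 2 powr (- real (Suc (level t))) \<le> t powr (s - 1)"
proof -
  define v where "v = (s - 1) * (- log 2 t)"
  have "log 2 t \<le> 0" using assms by (simp add: log_le_zero_cancel_iff)
  then have "v \<ge> 0" unfolding v_def using s by (intro mult_nonneg_nonneg) auto
  have v: "t powr (s - 1) = 2 powr (- v)"
  proof -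
    have "2 powr (- v) = (2 powr log 2 t) powr (s - 1)"
      unfolding powr_powr v_def by (simp add: mult.commute)
    then show ?thesis using assms by simp
  qed
  have "real (level t) \<le> v"
    using \<open>v \<ge> 0\<close> unfolding level_def v_def[symmetric] by linarith
  then show "t powr (s - 1) \<le> 2 powr (- real (level t))"
    unfolding v by (intro powr_mono) auto
  have "level t = top_level \<or> v \<le> real (Suc (level t))"
    using \<open>v \<ge> 0\<close> unfolding level_def v_def[symmetric] by linarith
  then show "level t = top_level \<or> 2 powr (- real (Suc (level t))) \<le> t powr (s - 1)"
    unfolding v by (auto simp del: of_nat_Suc)
qed

lemma lift_mean:
  assumes "j < m"
  shows "E (\<lambda>k. 2 ^ k j * lift a k j) = a j"
proof -
  let ?l = "level (\<bar>a j\<bar> / lp s {..<m} a)"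
  have "E (\<lambda>k. 2 ^ k j * lift a k j)
      = (\<Sum>l\<le>top_level. \<omega> l * (2 ^ l * (if l = ?l then a j / (\<omega> l * 2 ^ l) else 0)))"
    unfolding lift_def by (rule E_coordinate[OF assms])
  also have "\<dots> = (\<Sum>l\<le>top_level. if l = ?l then a j else 0)"
    using \<omega>_positive by (intro sum.cong refl) (simp add: less_imp_neq[THEN not_sym])
  also have "\<dots> = a j" using level_le by (simp only: sum.delta finite_atMost atMost_iff if_True)
  finally show ?thesis .
qed

lemma lift_scale: "lift (\<lambda>j. c * a j) k j = c * lift a k j"
  using s by (cases "c = 0") (auto simp: lift_def lp_scale abs_mult)

text \<open>Each entry is at most 2 in modulus and vanishes unless \<open>k j\<close> hits its
  level. The number of hits is a sum of independent indicators of bounded total probability, so its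
  exponential moment is bounded, and with it the moment of order \<open>r / 2\<close>.\<close>

lemma lift_moment:
  assumes unit: "lp s {..<m} a = 1"
  shows "E (\<lambda>k. lp 2 {..<m} (lift a k) powr r) \<le> 4 powr (r / 2) * (r / 2) powr (r / 2) * exp 9"
proof -
  let ?\<delta> = "2 powr (- \<sigma> * real top_level)"
  define hit :: "nat \<Rightarrow> nat \<Rightarrow> real" where "hit j l = (if l = level \<bar>a j\<bar> \<and> a j \<noteq> 0 then 1 else 0)" for j l
  have le_1: "\<bar>a j\<bar> \<le> 1" if "j < m" for j
    using lp_member[of s "{..<m}" j a] unit s that by simp
  have lift_le: "(lift a k j)\<^sup>2 \<le> 4 * hit j (k j)" if "j < m" for k j
  proof (cases "k j = level \<bar>a j\<bar> \<and> a j \<noteq> 0")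
    case True
    let ?l = "level \<bar>a j\<bar>"
    have pos: "\<bar>a j\<bar> > 0" using True by simp
    \<comment> \<open>As \<open>s - 1\<close> and \<open>\<sigma> - 1\<close> are reciprocal, the
      scale of the level becomes \<open>2 powr (- \<sigma> * real ?l) * 2 ^ ?l\<close>, at most
      twice the denominator of the lift.\<close>
    have "\<bar>a j\<bar> = (\<bar>a j\<bar> powr (s - 1)) powr (\<sigma> - 1)"
      unfolding powr_powr conjugate_simps using pos by simp
    also have "\<dots> \<le> (2 powr (- real ?l)) powr (\<sigma> - 1)"
      using level_bounds(1)[OF pos le_1[OF that]] \<sigma> by (intro powr_mono2) auto
    also have "\<dots> = 2 powr (- \<sigma> * real ?l) * 2 ^ ?l"
      unfolding powr_powr powr_realpow[of 2, symmetric, simplified]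
      by (simp add: algebra_simps flip: powr_add)
    also have "\<dots> \<le> 2 * (\<omega> ?l * 2 ^ ?l)"
      using mult_right_mono[OF \<omega>_ge[of ?l], of "2 ^ ?l"] by simp
    finally have "\<bar>lift a k j\<bar> \<le> 2"
      using True unit \<omega>_positive[of ?l] by (simp add: lift_def abs_mult pos_divide_le_eq)
    then have "\<bar>lift a k j\<bar>\<^sup>2 \<le> 2\<^sup>2" by (intro power_mono) auto
    then show ?thesis using True by (simp add: hit_def)
  next
    case False
    then show ?thesis using unit by (auto simp: lift_def hit_def)
  qed
  have hit_prob: "(\<Sum>l\<le>top_level. \<omega> l * hit j l) \<le> 4 * \<bar>a j\<bar> powr s + ?\<delta>" if "j < m" for j
  proof (cases "a j = 0")
    case False
    let ?l = "level \<bar>a j\<bar>"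
    have pos: "\<bar>a j\<bar> > 0" using False by simp
    have "(\<Sum>l\<le>top_level. \<omega> l * hit j l) = (\<Sum>l\<le>top_level. if l = ?l then \<omega> l else 0)"
      using False by (intro sum.cong refl) (simp add: hit_def)
    also have "\<dots> = \<omega> ?l" using level_le by (simp only: sum.delta finite_atMost atMost_iff if_True)
    also have "\<dots> \<le> 2 powr (- \<sigma> * real ?l)" by (rule \<omega>_le)
    also have "\<dots> \<le> 4 * \<bar>a j\<bar> powr s + ?\<delta>"
      using level_bounds(2)[OF pos le_1[OF that]]
    proof
      assume "?l = top_level"
      then show ?thesis by simp
    next
      assume "2 powr (- real (Suc ?l)) \<le> \<bar>a j\<bar> powr (s - 1)"
      then have "(2 powr (- real (Suc ?l))) powr \<sigma> \<le> (\<bar>a j\<bar> powr (s - 1)) powr \<sigma>"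
        using \<sigma> by (intro powr_mono2) auto
      then have *: "2 powr (- real (Suc ?l) * \<sigma>) \<le> \<bar>a j\<bar> powr s"
        unfolding powr_powr conjugate_simps .
      \<comment> \<open>Rounding the level costs the factor \<open>2 powr \<sigma>\<close>, which is
        at most 4.\<close>
      have "2 powr (- \<sigma> * real ?l) = 2 powr \<sigma> * 2 powr (- real (Suc ?l) * \<sigma>)"
        by (simp add: algebra_simps flip: powr_add)
      also have "\<dots> \<le> 2 powr 2 * \<bar>a j\<bar> powr s"
        using * \<sigma> by (intro mult_mono powr_mono) auto
      finally show ?thesis by (simp add: add_increasing2)
    qed
    finally show ?thesis .
  qed (simp add: hit_def)
  have "E (\<lambda>k. lp 2 {..<m} (lift a k) powr r)
      \<le> E (\<lambda>k. (4 powr (r / 2) * (r / 2) powr (r / 2)) * exp (\<Sum>j<m. hit j (k j)))"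
  proof (rule E_mono)
    fix k
    let ?Z = "\<Sum>j<m. hit j (k j)"
    have "0 \<le> ?Z" by (intro sum_nonneg) (simp add: hit_def)
    have "lp 2 {..<m} (lift a k) powr r = ((lp 2 {..<m} (lift a k))\<^sup>2) powr (r / 2)"
      by (simp add: powr_powr flip: powr_numeral)
    also have "\<dots> \<le> (4 * ?Z) powr (r / 2)"
      unfolding lp_2_square sum_distrib_left using s lift_le
      by (intro powr_mono2 sum_mono) (auto intro: sum_nonneg)
    also have "\<dots> = 4 powr (r / 2) * ?Z powr (r / 2)" by (rule powr_mult)
    also have "\<dots> \<le> 4 powr (r / 2) * ((r / 2) powr (r / 2) * exp ?Z)"
      using \<open>0 \<le> ?Z\<close> s by (intro mult_left_mono powr_le_exp) auto
    finally show "lp 2 {..<m} (lift a k) powr r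
        \<le> (4 powr (r / 2) * (r / 2) powr (r / 2)) * exp ?Z" by (simp add: mult.assoc)
  qed
  also have "\<dots> = (4 powr (r / 2) * (r / 2) powr (r / 2)) * (\<Prod>j<m. \<Sum>l\<le>top_level. \<omega> l * exp (hit j l))"
    unfolding E_cmult E_exp_sum ..
  also have "(\<Prod>j<m. \<Sum>l\<le>top_level. \<omega> l * exp (hit j l)) \<le> (\<Prod>j<m. exp (2 * (4 * \<bar>a j\<bar> powr s + ?\<delta>)))"
  proof (intro prod_mono conjI)
    fix j assume j: "j \<in> {..<m}"
    show "0 \<le> (\<Sum>l\<le>top_level. \<omega> l * exp (hit j l))"
      using \<omega>_positive by (intro sum_nonneg) (simp add: less_imp_le)
    have "(\<Sum>l\<le>top_level. \<omega> l * exp (hit j l)) \<le> (\<Sum>l\<le>top_level. \<omega> l * 1 + 2 * (\<omega> l * hit j l))"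
    proof (rule sum_mono)
      fix l
      have "exp (hit j l) \<le> 1 + 2 * hit j l" using exp_le by (simp add: hit_def)
      then have "\<omega> l * exp (hit j l) \<le> \<omega> l * (1 + 2 * hit j l)"
        using \<omega>_positive[of l] by (intro mult_left_mono) auto
      then show "\<omega> l * exp (hit j l) \<le> \<omega> l * 1 + 2 * (\<omega> l * hit j l)"
        by (simp add: algebra_simps)
    qed
    also have "\<dots> = 1 + 2 * (\<Sum>l\<le>top_level. \<omega> l * hit j l)"
      unfolding sum.distrib sum_distrib_left[symmetric] mult_1_right \<omega>_sum ..
    also have "\<dots> \<le> 1 + 2 * (4 * \<bar>a j\<bar> powr s + ?\<delta>)"
      using hit_prob[of j] j by simp
    also have "\<dots> \<le> exp (2 * (4 * \<bar>a j\<bar> powr s + ?\<delta>))" by (rule exp_ge_add_one_self)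
    finally show "(\<Sum>l\<le>top_level. \<omega> l * exp (hit j l)) \<le> exp (2 * (4 * \<bar>a j\<bar> powr s + ?\<delta>))" .
  qed
  also have "\<dots> = exp (2 * (4 * (\<Sum>j<m. \<bar>a j\<bar> powr s) + real m * ?\<delta>))"
    by (simp add: sum.distrib sum_distrib_left flip: exp_sum)
  \<comment> \<open>The exponent is at most \<open>2 * (4 + 1 / 2) = 9\<close>: the powers add up to
    1 and the terms \<open>?\<delta>\<close> to at most 1 / 2.\<close>
  also have "\<dots> \<le> exp 9"
  proof -
    have "(\<Sum>j<m. \<bar>a j\<bar> powr s) = 1" using lp_powr[of s "{..<m}" a] unit s by simp
    then show ?thesis using top_level_weight by simp
  qed
  finally show ?thesis by (simp add: mult_left_mono)
qed

lemma lift_norm_le: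
  "lp r \<Omega> (\<lambda>k. lp 2 {..<m} (\<lambda>j. W k powr (1 / r) * lift a k j))
    \<le> (4 powr (r / 2) * (r / 2) powr (r / 2) * exp 9) powr (1 / r) * lp s {..<m} a"
proof (rule lp_bounded_by_normalized)
  fix a :: "nat \<Rightarrow> real" assume unit: "lp s {..<m} a = 1"
  have "lp r \<Omega> (\<lambda>k. lp 2 {..<m} (\<lambda>j. W k powr (1 / r) * lift a k j))
      = E (\<lambda>k. lp 2 {..<m} (lift a k) powr r) powr (1 / r)"
    using lp_weighted[of r "\<lambda>k. lp 2 {..<m} (lift a k)"] s by (simp add: lp_scale)
  also have "\<dots> \<le> (4 powr (r / 2) * (r / 2) powr (r / 2) * exp 9) powr (1 / r)"
    using lift_moment[OF unit] s by (intro powr_mono2 E_nonneg) auto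
  finally show "lp r \<Omega> (\<lambda>k. lp 2 {..<m} (\<lambda>j. W k powr (1 / r) * lift a k j)) \<le> \<dots>" .
next
  fix a b :: "nat \<Rightarrow> real" assume eq: "\<And>i. i \<in> {..<m} \<Longrightarrow> a i = b i"
  then have "lp s {..<m} a = lp s {..<m} b" by (intro lp_cong) simp
  then have "lp 2 {..<m} (\<lambda>j. W k powr (1 / r) * lift a k j)
      = lp 2 {..<m} (\<lambda>j. W k powr (1 / r) * lift b k j)" for k
    using eq by (intro lp_cong) (simp add: lift_def)
  then show "lp r \<Omega> (\<lambda>k. lp 2 {..<m} (\<lambda>j. W k powr (1 / r) * lift a k j))
      = lp r \<Omega> (\<lambda>k. lp 2 {..<m} (\<lambda>j. W k powr (1 / r) * lift b k j))" by simp
next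
  fix c and a :: "nat \<Rightarrow> real"
  show "lp r \<Omega> (\<lambda>k. lp 2 {..<m} (\<lambda>j. W k powr (1 / r) * lift (\<lambda>i. c * a i) k j))
      = \<bar>c\<bar> * lp r \<Omega> (\<lambda>k. lp 2 {..<m} (\<lambda>j. W k powr (1 / r) * lift a k j))"
    unfolding lift_scale mult.left_commute[of _ c] using s by (simp add: lp_scale)
qed (use s in auto)

text \<open>The nonlinear lift is applied pointwise, so its values enter the function space through
  the ideal property, which asks for measurability.\<close>

lemma lift_measurable:
  assumes "\<And>j. j < m \<Longrightarrow> x j \<in> borel_measurable M" "j < m"
  shows "(\<lambda>w. lift (\<lambda>j. x j w) k j) \<in> borel_measurable M"
proof -
  have "(\<lambda>t. \<lfloor>(s - 1) * (- log 2 t)\<rfloor>) \<in> measurable borel (count_space UNIV)"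
    by measurable
  then have [measurable]: "level \<in> measurable borel (count_space UNIV)"
    unfolding level_def[abs_def] by (rule measurable_compose) simp
  have [measurable]: "(\<lambda>w. lp s {..<m} (\<lambda>j. x j w)) \<in> borel_measurable M" "x j \<in> borel_measurable M"
    using assms by (auto intro: lp_measurable)
  show ?thesis unfolding lift_def by measurable
qed

text \<open>By duality: the vector is paired with its norming element in the unit sphere of
  \<open>\<ell>^\<sigma>\<close> and the sums are exchanged. Cauchy-Schwarz in \<open>j\<close> and
  Young's inequality for each \<open>k\<close> leave the unit norm of \<open>c\<close> plus a moment
  bounded by \<open>moment_le\<close>.\<close>

lemma quotient_le_normalized:
  assumes unit: "lp r \<Omega> (\<lambda>k. lp 2 {..<m} (c k)) = 1"
  shows "lp s {..<m} (\<lambda>j. \<Sum>k\<in>\<Omega>. (W k powr (1 - 1 / r) * 2 ^ k j) * c k j)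
    \<le> 2 + dyadic_const \<sigma> (r / (r - 1))"
proof -
  define \<rho> where "\<rho> = r / (r - 1)"
  \<comment> \<open>\<open>s < r\<close> enters as \<open>\<rho> < \<sigma>\<close>, and
    \<open>1 - 1 / r = 1 / \<rho>\<close> matches the weights of the quotient map with those of
    \<open>scaled_norm\<close>.\<close>
  have \<rho>: "0 < \<rho>" "\<rho> < \<sigma>" "1 - 1 / r = 1 / \<rho>" "1 < r"
    unfolding \<rho>_def conjugate using s by (auto simp: field_simps)
  define e where "e j = (\<Sum>k\<in>\<Omega>. (W k powr (1 - 1 / r) * 2 ^ k j) * c k j)" for j
  define N where "N = lp s {..<m} e"
  show ?thesis
  proof (cases "N = 0")
    case True
    then show ?thesis
      using dyadic_const_pos[of \<rho> \<sigma>] \<rho> \<sigma> unfolding N_def e_def[abs_def] \<rho>_def by simp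
  next
    case False
    then have "N > 0" using lp_nonneg[of s "{..<m}" e] unfolding N_def by linarith
    have N_powr: "N powr s = (\<Sum>j<m. \<bar>e j\<bar> powr s)"
      unfolding N_def using s by (simp add: lp_powr)
    \<comment> \<open>The norming vector of \<open>e\<close>: its
      \<open>\<ell>^\<sigma>\<close>-norm is 1 and its pairing with \<open>e\<close> is
      \<open>N\<close>.\<close>
    define u where "u j = sgn (e j) * (\<bar>e j\<bar> / N) powr (s - 1)" for j
    have "(\<Sum>j<m. \<bar>u j\<bar> powr \<sigma>) = (\<Sum>j<m. (\<bar>e j\<bar> / N) powr s)"
    proof (intro sum.cong refl)
      fix j
      show "\<bar>u j\<bar> powr \<sigma> = (\<bar>e j\<bar> / N) powr s"
        unfolding u_def by (cases "e j = 0") (simp_all add: abs_mult abs_sgn_eq powr_powr conjugate_simps)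
    qed
    also have "\<dots> = (\<Sum>j<m. \<bar>e j\<bar> powr s) / N powr s"
      using \<open>N > 0\<close> by (simp add: powr_divide flip: sum_divide_distrib)
    also have "\<dots> = 1"
      unfolding N_powr[symmetric] using \<open>N > 0\<close> by simp
    finally have u: "lp \<sigma> {..<m} u = 1" by (simp add: lp_def)
    have "N = N powr s / N powr (s - 1)"
      using \<open>N > 0\<close> by (simp flip: powr_diff)
    also have "\<dots> = (\<Sum>j<m. u j * e j)"
      unfolding N_powr sum_divide_distrib
    proof (intro sum.cong refl)
      fix j
      have "\<bar>e j\<bar> powr (s - 1) * \<bar>e j\<bar> = \<bar>e j\<bar> powr s"
        by (cases "e j = 0") (use s in \<open>auto simp: powr_diff\<close>)
      moreover have "u j * e j = (\<bar>e j\<bar> / N) powr (s - 1) * \<bar>e j\<bar>"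
        unfolding u_def by (simp add: abs_sgn mult_ac)
      ultimately show "\<bar>e j\<bar> powr s / N powr (s - 1) = u j * e j"
        using \<open>N > 0\<close> by (simp add: powr_divide)
    qed
    also have "\<dots> = (\<Sum>k\<in>\<Omega>. \<Sum>j<m. c k j * (W k powr (1 / \<rho>) * 2 ^ k j * u j))"
      unfolding e_def sum_distrib_left \<rho>(3) by (subst sum.swap) (simp add: mult_ac)
    also have "\<dots> \<le> (\<Sum>k\<in>\<Omega>. lp 2 {..<m} (c k) powr r
        + lp 2 {..<m} (\<lambda>j. W k powr (1 / \<rho>) * 2 ^ k j * u j) powr \<rho>)"
    proof (rule sum_mono)
      fix k
      let ?v = "\<lambda>j. W k powr (1 / \<rho>) * 2 ^ k j * u j"
      have L2: "lp 2 {..<m} f = L2_set f {..<m}" for f :: "nat \<Rightarrow> real"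
        unfolding L2_set_def lp_2_square[symmetric] by simp
      have "(\<Sum>j<m. c k j * ?v j) \<le> (\<Sum>j<m. \<bar>c k j\<bar> * \<bar>?v j\<bar>)"
        by (intro sum_mono) (simp flip: abs_mult)
      also have "\<dots> \<le> lp 2 {..<m} (c k) * lp 2 {..<m} ?v"
        unfolding L2 by (rule L2_set_mult_ineq)
      also have "\<dots> \<le> lp 2 {..<m} (c k) powr r + lp 2 {..<m} ?v powr \<rho>"
        using \<rho> by (intro mult_le_powr_conjugate) (auto simp: \<rho>_def)
      finally show "(\<Sum>j<m. c k j * ?v j) \<le> lp 2 {..<m} (c k) powr r + lp 2 {..<m} ?v powr \<rho>" .
    qed
    also have "\<dots> = 1 + scaled_norm \<rho> u powr \<rho>"
      using lp_powr[of r \<Omega> "\<lambda>k. lp 2 {..<m} (c k)"] unit \<rho>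
      by (simp add: sum.distrib scaled_norm_def lp_powr)
    also have "\<dots> \<le> 1 + (1 + dyadic_const \<sigma> \<rho>)"
    proof -
      have "scaled_norm \<rho> u powr \<rho> = E (\<lambda>k. lp 2 {..<m} (\<lambda>j. 2 ^ k j * u j) powr \<rho>)"
        unfolding scaled_norm_eq[OF \<rho>(1)] using \<rho> by (simp add: powr_powr E_nonneg)
      then show ?thesis using moment_le[OF \<rho>(1,2) u] by simp
    qed
    finally show ?thesis unfolding N_def e_def[abs_def] \<rho>_def by simp
  qed
qed

lemma quotient_le:
  "lp s {..<m} (\<lambda>j. \<Sum>k\<in>\<Omega>. (W k powr (1 - 1 / r) * 2 ^ k j) * c k j)
    \<le> (2 + dyadic_const \<sigma> (r / (r - 1))) * lp r \<Omega> (\<lambda>k. lp 2 {..<m} (c k))"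
proof (cases "lp r \<Omega> (\<lambda>k. lp 2 {..<m} (c k)) = 0")
  case True
  have "c k j = 0" if "k \<in> \<Omega>" "j < m" for k j
  proof -
    have "\<bar>c k j\<bar> \<le> lp 2 {..<m} (c k)"
      using that by (intro lp_member) auto
    also have "\<dots> \<le> 0"
      using lp_member[of r \<Omega> k "\<lambda>k. lp 2 {..<m} (c k)"] that True s finite_\<Omega> by simp
    finally show ?thesis by simp
  qed
  then have "lp s {..<m} (\<lambda>j. \<Sum>k\<in>\<Omega>. (W k powr (1 - 1 / r) * 2 ^ k j) * c k j) = lp s {..<m} (\<lambda>j. 0)"
    by (intro lp_cong) simp
  then show ?thesis using True by simp
next
  case False
  define D where "D = lp r \<Omega> (\<lambda>k. lp 2 {..<m} (c k))"
  have "D > 0" using False lp_nonneg[of r \<Omega> "\<lambda>k. lp 2 {..<m} (c k)"] unfolding D_def by linarith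
  have "lp r \<Omega> (\<lambda>k. lp 2 {..<m} (\<lambda>j. (1 / D) * c k j)) = \<bar>1 / D\<bar> * lp r \<Omega> (\<lambda>k. lp 2 {..<m} (c k))"
    using lp_scale[of r \<Omega> "\<bar>1 / D\<bar>" "\<lambda>k. lp 2 {..<m} (c k)"] s by (simp only: lp_scale)
  also have "\<dots> = 1" using \<open>D > 0\<close> unfolding D_def[symmetric] by simp
  finally have "lp s {..<m} (\<lambda>j. \<Sum>k\<in>\<Omega>. (W k powr (1 - 1 / r) * 2 ^ k j) * ((1 / D) * c k j))
      \<le> 2 + dyadic_const \<sigma> (r / (r - 1))"
    by (rule quotient_le_normalized)
  also have "(\<lambda>j. \<Sum>k\<in>\<Omega>. (W k powr (1 - 1 / r) * 2 ^ k j) * ((1 / D) * c k j))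
      = (\<lambda>j. (1 / D) * (\<Sum>k\<in>\<Omega>. (W k powr (1 - 1 / r) * 2 ^ k j) * c k j))"
    unfolding sum_distrib_left by (simp only: mult.left_commute)
  also have "lp s {..<m} \<dots>
      = \<bar>1 / D\<bar> * lp s {..<m} (\<lambda>j. \<Sum>k\<in>\<Omega>. (W k powr (1 - 1 / r) * 2 ^ k j) * c k j)"
    using s by (intro lp_scale) simp
  finally show ?thesis
    using \<open>D > 0\<close> unfolding D_def[symmetric] by (simp add: pos_divide_le_eq)
qed

end

text \<open>Although the lift is nonlinear, \<open>x\<close> is recovered from \<open>z\<close> by
  fixed linear combinations, which \<open>T\<close> respects. The bound of the quotient map then
  applies to the functions \<open>T (z k j)\<close>.\<close>

lemma mixed_bounded_above_2:
  assumes T: "bounded_operator X NX \<nu> Y NY T"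
    and X: "banach_function_space \<mu> X NX" and Y: "banach_function_space \<nu> Y NY"
    and s: "2 < s" "s < r" and bounded: "mixed_bounded X NX NY T r 2"
  shows "mixed_bounded X NX NY T r s"
proof -
  define \<sigma> where "\<sigma> = s / (s - 1)"
  have weights: "pareto_dual \<sigma> s r"
    using s by unfold_locales (auto simp: \<sigma>_def field_simps)
  interpret pareto_dual m \<sigma> s r for m
    by (rule weights)
  define C where "C = (4 powr (r / 2) * (r / 2) powr (r / 2) * exp 9) powr (1 / r)
      + (2 + dyadic_const \<sigma> (r / (r - 1)))"
  have "r / (r - 1) < \<sigma>" "\<sigma> < 2"
    unfolding \<sigma>_def using s by (auto simp: field_simps)
  from dyadic_const_pos[OF this]
  have parts: "0 \<le> (4 powr (r / 2) * (r / 2) powr (r / 2) * exp 9) powr (1 / r)"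
      "0 < 2 + dyadic_const \<sigma> (r / (r - 1))"
    by auto
  then have "C > 0" unfolding C_def by linarith
  have le_C: "y \<le> C * t" if "0 \<le> t"
      "y \<le> (4 powr (r / 2) * (r / 2) powr (r / 2) * exp 9) powr (1 / r) * t \<or>
       y \<le> (2 + dyadic_const \<sigma> (r / (r - 1))) * t" for y t
  proof -
    have "(4 powr (r / 2) * (r / 2) powr (r / 2) * exp 9) powr (1 / r) * t \<le> C * t"
        "(2 + dyadic_const \<sigma> (r / (r - 1))) * t \<le> C * t"
      using parts that(1) unfolding C_def by (auto intro!: mult_right_mono)
    with that(2) show ?thesis by (meson order_trans)
  qed
  have upper: "lp r (\<Omega> m) (\<lambda>k. lp 2 {..<m} (\<lambda>j. W m k powr (1 / r) * lift m a k j)) \<le> C * lp s {..<m} a"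
    for m a
    by (intro le_C disjI1 lift_norm_le lp_nonneg)
  have lower: "lp s {..<m} (\<lambda>j. \<Sum>k\<in>\<Omega> m. (W m k powr (1 - 1 / r) * 2 ^ k j) * c k j)
      \<le> C * lp r (\<Omega> m) (\<lambda>k. lp 2 {..<m} (c k))" for m c
    by (intro le_C disjI2 quotient_le lp_nonneg)
  show ?thesis
  proof (rule mixed_bounded_transfer[OF T X Y _ _ _ \<open>C > 0\<close> bounded,
        where \<Omega> = \<Omega> and B = "\<lambda>m. {..<m}"])
    fix m and x :: "nat \<Rightarrow> 'a \<Rightarrow> real" assume x: "\<And>j. j < m \<Longrightarrow> x j \<in> X"
    define z where "z k l w = W m k powr (1 / r) * lift m (\<lambda>j. x j w) k l" for k l w
    have z_norm: "lp r (\<Omega> m) (\<lambda>k. lp 2 {..<m} (\<lambda>l. z k l w)) \<le> C * lp s {..<m} (\<lambda>j. x j w)" for w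
      unfolding z_def by (rule upper)
    have z: "z k l \<in> X" if "k \<in> \<Omega> m" "l < m" for k l
    proof (rule banach_function_space.ideal[OF X])
      have "(\<lambda>w. lift m (\<lambda>j. x j w) k l) \<in> borel_measurable \<mu>"
        using x that banach_function_space.measurable[OF X] by (intro lift_measurable) auto
      then show "z k l \<in> borel_measurable \<mu>"
        unfolding z_def[abs_def] by measurable
      show "(\<lambda>w. C * lp s {..<m} (\<lambda>j. x j w)) \<in> X"
        using x s by (intro banach_function_space.scale_closed[OF X] banach_function_space.lp_closed[OF X]) auto
      have "\<bar>z k l w\<bar> \<le> C * lp s {..<m} (\<lambda>j. x j w)" for w
      proof -
        have "\<bar>z k l w\<bar> \<le> lp 2 {..<m} (\<lambda>l. z k l w)"
          using that by (intro lp_member) auto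
        also have "\<dots> \<le> lp r (\<Omega> m) (\<lambda>k. lp 2 {..<m} (\<lambda>l. z k l w))"
          using lp_member[of r "\<Omega> m" k "\<lambda>k. lp 2 {..<m} (\<lambda>l. z k l w)"] that s finite_\<Omega> by simp
        finally show ?thesis using z_norm[of w] by linarith
      qed
      then show "AE w in \<mu>. \<bar>z k l w\<bar> \<le> \<bar>C * lp s {..<m} (\<lambda>j. x j w)\<bar>"
        using \<open>C > 0\<close> by simp
    qed
    \<comment> \<open>This is \<open>lift_mean\<close> at every point \<open>w\<close>, with
      \<open>W m k\<close> split into its powers of exponents \<open>1 / r\<close>, already
      contained in \<open>z\<close>, and \<open>1 - 1 / r\<close>.\<close>
    have recover: "x j = (\<lambda>w. \<Sum>k\<in>\<Omega> m. (W m k powr (1 - 1 / r) * 2 ^ k j) * z k j w)" if "j < m" for j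
    proof
      fix w
      have "x j w = E m (\<lambda>k. 2 ^ k j * lift m (\<lambda>j. x j w) k j)"
        using lift_mean[OF that] by simp
      also have "\<dots> = (\<Sum>k\<in>\<Omega> m. (W m k powr (1 - 1 / r) * 2 ^ k j) * z k j w)"
        unfolding E_def
      proof (intro sum.cong refl)
        fix k assume "k \<in> \<Omega> m"
        then have "W m k powr (1 - 1 / r) * W m k powr (1 / r) = W m k"
          using W_pos[of k m] by (simp flip: powr_add)
        moreover have "(W m k powr (1 - 1 / r) * 2 ^ k j) * z k j w
            = (W m k powr (1 - 1 / r) * W m k powr (1 / r)) * (2 ^ k j * lift m (\<lambda>j. x j w) k j)"
          unfolding z_def by (simp only: mult_ac)
        ultimately show "W m k * (2 ^ k j * lift m (\<lambda>j. x j w) k j)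
            = (W m k powr (1 - 1 / r) * 2 ^ k j) * z k j w"
          by simp
      qed
      finally show "x j w = (\<Sum>k\<in>\<Omega> m. (W m k powr (1 - 1 / r) * 2 ^ k j) * z k j w)" .
    qed
    have "AE w in \<nu>. T (x j) w = (\<Sum>k\<in>\<Omega> m. (W m k powr (1 - 1 / r) * 2 ^ k j) * T (z k j) w)"
      if "j < m" for j
      by (subst recover[OF that], rule bounded_operator_lincomb[OF T X finite_\<Omega>]) (rule z[OF _ that])
    then have "AE w in \<nu>. \<forall>j\<in>{..<m}.
        T (x j) w = (\<Sum>k\<in>\<Omega> m. (W m k powr (1 - 1 / r) * 2 ^ k j) * T (z k j) w)"
      by (intro AE_finite_allI) auto
    then have Tz: "AE w in \<nu>. lp s {..<m} (\<lambda>j. T (x j) w)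
        \<le> C * lp r (\<Omega> m) (\<lambda>k. lp 2 {..<m} (\<lambda>l. T (z k l) w))"
    proof eventually_elim
      case (elim w)
      then have "lp s {..<m} (\<lambda>j. T (x j) w)
          = lp s {..<m} (\<lambda>j. \<Sum>k\<in>\<Omega> m. (W m k powr (1 - 1 / r) * 2 ^ k j) * T (z k j) w)"
        by (intro lp_cong) simp
      then show ?case using lower[of m "\<lambda>k j. T (z k j) w"] by simp
    qed
    show "\<exists>z. (\<forall>k\<in>\<Omega> m. \<forall>l\<in>{..<m}. z k l \<in> X) \<and>
          (\<forall>w. lp r (\<Omega> m) (\<lambda>k. lp 2 {..<m} (\<lambda>l. z k l w)) \<le> C * lp s {..<m} (\<lambda>j. x j w)) \<and>
          (AE w in \<nu>. lp s {..<m} (\<lambda>j. T (x j) w)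
             \<le> C * lp r (\<Omega> m) (\<lambda>k. lp 2 {..<m} (\<lambda>l. T (z k l) w)))"
      using z z_norm Tz by (intro exI[of _ z]) auto
  qed (use s finite_\<Omega> in auto)
qed

section \<open>All inner exponents between \<open>r\<close> and 2, and the equivalence\<close>

lemma regular_imp_mixed_bounded_between:
  assumes T: "bounded_operator X NX \<nu> Y NY T"
    and X: "banach_function_space \<mu> X NX" and Y: "banach_function_space \<nu> Y NY"
    and "1 < r" and s: "min r 2 \<le> s" "s \<le> max r 2"
    and reg: "regular_operator (ereal r) X NX NY T"
  shows "mixed_bounded X NX NY T r s"
proof -
  have bounded_r: "mixed_bounded X NX NY T r r"
    using reg \<open>1 < r\<close> by (intro regular_imp_mixed_bounded) auto
  then have bounded_2: "mixed_bounded X NX NY T r 2"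
    using mixed_bounded_2[OF T X Y] \<open>1 < r\<close> by simp
  consider "s = r" | "s = 2" | "r < s" "s < 2" | "2 < s" "s < r"
    using s by (cases "s = r"; cases "s = 2"; cases "r \<le> 2") auto
  then show ?thesis
  proof cases
    case 3
    then show ?thesis using mixed_bounded_below_2[OF T X Y _ _ _ bounded_2] \<open>1 < r\<close> by simp
  next
    case 4
    then show ?thesis by (rule mixed_bounded_above_2[OF T X Y _ _ bounded_2])
  qed (use bounded_r bounded_2 in auto)
qed

lemma ell_measurable:
  assumes "\<And>j. j < m \<Longrightarrow> a j \<in> borel_measurable M"
  shows "(\<lambda>w. ell p m (\<lambda>j. a j w)) \<in> borel_measurable M"
proof (cases "p = \<infinity>")
  case True
  show ?thesis
    using assms
  proof (induction m)
    case (Suc m)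
    have "ell \<infinity> (Suc m) b = max (ell \<infinity> m b) \<bar>b m\<bar>" for b
      unfolding ell_def by (simp add: lessThan_Suc insert_commute[of 0] max.commute)
    moreover have "(\<lambda>w. ell \<infinity> m (\<lambda>j. a j w)) \<in> borel_measurable M" "a m \<in> borel_measurable M"
      using Suc True by auto
    ultimately show ?case using True by simp
  qed (simp add: ell_def True)
next
  case False
  then show ?thesis unfolding ell_def using assms by simp
qed

lemma ell_1:
  assumes "1 \<le> p"
  shows "ell p 1 a = \<bar>a 0\<bar>"
proof (cases p)
  case (real p')
  then show ?thesis using assms by (simp add: ell_def powr_powr)
qed (use assms in \<open>auto simp: ell_def lessThan_Suc\<close>)

theorem corollary4p7:
  fixes \<mu> :: "'a measure" and \<nu> :: "'b measure"
    and X :: "('a \<Rightarrow> real) set" and NX :: "('a \<Rightarrow> real) \<Rightarrow> real"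
    and Y :: "('b \<Rightarrow> real) set" and NY :: "('b \<Rightarrow> real) \<Rightarrow> real"
    and T :: "('a \<Rightarrow> real) \<Rightarrow> 'b \<Rightarrow> real"
    and p q :: ereal and r :: real
  assumes "1 \<le> p" and "1 \<le> q" and "1 < r"
    and "banach_function_space \<mu> X NX" and "lattice_convex (ereal r) X NX"
    and "banach_function_space \<nu> Y NY" and "lattice_concave (ereal r) Y NY"
    and "order_continuous_norm X (ae_le \<mu>) NX"
    and "order_continuous_norm (dual_carrier Y NY) (dual_le \<nu> Y) (dual_norm Y NY)"
    and "bounded_operator X NX \<nu> Y NY T"
    and "{q..p} \<inter> {ereal (min r 2)..ereal (max r 2)} \<noteq> {}"
  shows "regular_operator (ereal r) X NX NY T \<longleftrightarrow>
    (\<exists>K>0. \<forall>(n::nat) (m::nat) x. (\<forall>i<n. \<forall>j<m. x i j \<in> X) \<longrightarrow>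
       NY (\<lambda>w. (\<Sum>i<n. ell p m (\<lambda>j. T (x i j) w) powr r) powr (1 / r))
       \<le> K * NX (\<lambda>w. (\<Sum>i<n. ell q m (\<lambda>j. x i j w) powr r) powr (1 / r)))"
    (is "_ \<longleftrightarrow> ?mixed")
proof
  note X = assms(4) and Y = assms(6) and T = assms(10)
  have mixed: "(\<lambda>w. (\<Sum>i<n. ell t m (y i w) powr r) powr (1 / r)) = (\<lambda>w. lp r {..<n} (\<lambda>i. ell t m (y i w)))"
    for t and n m :: nat and y :: "nat \<Rightarrow> 'c \<Rightarrow> nat \<Rightarrow> real"
    unfolding lp_def by (simp add: ell_nonneg)
  assume reg: "regular_operator (ereal r) X NX NY T"
  obtain s where s: "q \<le> ereal s" "ereal s \<le> p" "min r 2 \<le> s" "s \<le> max r 2"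
  proof -
    from assms(11) obtain s' where "s' \<in> {q..p} \<inter> {ereal (min r 2)..ereal (max r 2)}"
      by blast
    then have s': "q \<le> s'" "s' \<le> p" "ereal (min r 2) \<le> s'" "s' \<le> ereal (max r 2)"
      unfolding Int_iff atLeastAtMost_iff by blast+
    then obtain u where u: "s' = ereal u"
      by (metis MInfty_neq_ereal(1) PInfty_neq_ereal(1) ereal_infty_less_eq(1,2) ereal_cases)
    show ?thesis
      by (rule that[of u]) (use s' in \<open>simp_all only: u ereal_less_eq\<close>)
  qed
  \<comment> \<open>A real \<open>s\<close> above \<open>q\<close> makes \<open>q\<close> real, so
    that \<open>mixed_closed\<close> places the right-hand expression in \<open>X\<close>.\<close>
  obtain q' where q': "q = ereal q'" "1 \<le> q'"
    using s(1) \<open>1 \<le> q\<close> by (cases q) auto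
  have "1 \<le> s" using s(3) \<open>1 < r\<close> by auto
  obtain K where "K > 0" and K: "\<And>(n::nat) (m::nat) x. (\<forall>i<n. \<forall>j<m. x i j \<in> X) \<Longrightarrow>
        NY (\<lambda>w. lp r {..<n} (\<lambda>i. lp s {..<m} (\<lambda>j. T (x i j) w)))
        \<le> K * NX (\<lambda>w. lp r {..<n} (\<lambda>i. lp s {..<m} (\<lambda>j. x i j w)))"
    using regular_imp_mixed_bounded_between[OF T X Y \<open>1 < r\<close> s(3,4) reg]
    unfolding mixed_bounded_def by blast
  have "NY (\<lambda>w. lp r {..<n} (\<lambda>i. ell p m (\<lambda>j. T (x i j) w)))
      \<le> K * NX (\<lambda>w. lp r {..<n} (\<lambda>i. ell q m (\<lambda>j. x i j w)))"
    if x: "\<forall>i<n. \<forall>j<m. x i j \<in> X" for n m :: nat and x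
  proof -
    have Tx: "T (x i j) \<in> Y" if "i < n" "j < m" for i j
      using bounded_operatorD(1)[OF T] x that by blast
    have le_s: "lp r {..<n} (\<lambda>i. ell p m (\<lambda>j. T (x i j) w))
        \<le> lp r {..<n} (\<lambda>i. lp s {..<m} (\<lambda>j. T (x i j) w))" for w
      using \<open>1 < r\<close> \<open>1 \<le> s\<close> s(2) by (intro lp_mono) (auto simp: ell_nonneg intro: ell_le_lp)
    have in_Y: "(\<lambda>w. lp r {..<n} (\<lambda>i. lp s {..<m} (\<lambda>j. T (x i j) w))) \<in> Y"
      using \<open>1 < r\<close> \<open>1 \<le> s\<close> Tx by (intro banach_function_space.mixed_closed[OF Y]) auto
    \<comment> \<open>\<open>p\<close> may be infinite, so membership in \<open>Y\<close> comes from
      the ideal property by comparison with the exponent \<open>s\<close>.\<close>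
    have "(\<lambda>w. lp r {..<n} (\<lambda>i. ell p m (\<lambda>j. T (x i j) w))) \<in> borel_measurable \<nu>"
      using Tx banach_function_space.measurable[OF Y] by (intro lp_measurable ell_measurable) auto
    then have "(\<lambda>w. lp r {..<n} (\<lambda>i. ell p m (\<lambda>j. T (x i j) w))) \<in> Y"
      by (rule banach_function_space.ideal[OF Y _ in_Y]) (use le_s in simp)
    then have "NY (\<lambda>w. lp r {..<n} (\<lambda>i. ell p m (\<lambda>j. T (x i j) w)))
        \<le> NY (\<lambda>w. lp r {..<n} (\<lambda>i. lp s {..<m} (\<lambda>j. T (x i j) w)))"
      using in_Y le_s by (intro banach_function_space.norm_lattice[OF Y]) auto
    also have "\<dots> \<le> K * NX (\<lambda>w. lp r {..<n} (\<lambda>i. lp s {..<m} (\<lambda>j. x i j w)))"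
      by (rule K[OF x])
    also have "\<dots> \<le> K * NX (\<lambda>w. lp r {..<n} (\<lambda>i. ell q m (\<lambda>j. x i j w)))"
    proof (intro mult_left_mono banach_function_space.norm_lattice[OF X])
      show "(\<lambda>w. lp r {..<n} (\<lambda>i. lp s {..<m} (\<lambda>j. x i j w))) \<in> X"
        using \<open>1 < r\<close> \<open>1 \<le> s\<close> x by (intro banach_function_space.mixed_closed[OF X]) auto
      show "(\<lambda>w. lp r {..<n} (\<lambda>i. ell q m (\<lambda>j. x i j w))) \<in> X"
        unfolding q'(1) ell_ereal using \<open>1 < r\<close> q'(2) x
        by (intro banach_function_space.mixed_closed[OF X]) auto
      have "lp r {..<n} (\<lambda>i. lp s {..<m} (\<lambda>j. x i j w)) \<le> lp r {..<n} (\<lambda>i. ell q m (\<lambda>j. x i j w))" for w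
        using \<open>1 < r\<close> \<open>1 \<le> q\<close> s(1) by (intro lp_mono) (auto simp: ell_nonneg intro: lp_le_ell)
      then show "AE w in \<mu>. \<bar>lp r {..<n} (\<lambda>i. lp s {..<m} (\<lambda>j. x i j w))\<bar>
          \<le> \<bar>lp r {..<n} (\<lambda>i. ell q m (\<lambda>j. x i j w))\<bar>" by simp
    qed (use \<open>K > 0\<close> in auto)
    finally show ?thesis .
  qed
  with \<open>K > 0\<close> show ?mixed unfolding mixed by blast
next
  assume ?mixed
  then obtain K where "K > 0" and K: "\<And>(n::nat) (m::nat) x. (\<forall>i<n. \<forall>j<m. x i j \<in> X) \<Longrightarrow>
       NY (\<lambda>w. (\<Sum>i<n. ell p m (\<lambda>j. T (x i j) w) powr r) powr (1 / r))
       \<le> K * NX (\<lambda>w. (\<Sum>i<n. ell q m (\<lambda>j. x i j w) powr r) powr (1 / r))"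
    by blast
  \<comment> \<open>For matrices with a single column both inner expressions reduce to the
    modulus.\<close>
  have "NY (\<lambda>w. ell (ereal r) n (\<lambda>i. T (x i) w)) \<le> K * NX (\<lambda>w. ell (ereal r) n (\<lambda>i. x i w))"
    if "\<forall>i<n. x i \<in> X" for n x
    using K[of n 1 "\<lambda>i j. x i"] that
    unfolding ell_1[OF \<open>1 \<le> p\<close>] ell_1[OF \<open>1 \<le> q\<close>] ell_ereal lp_def by simp
  with \<open>K > 0\<close> show "regular_operator (ereal r) X NX NY T"
    unfolding regular_operator_def by blast
qed

end
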